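(* Let $G$ be a $k$-regular and $f$-equitable graph of order $n$ with quotient matrix $B$ (indexed by $x_0,x_1,\ldots,x_r$). Define $\lambda_1=\frac{k}{2}+\sqrt{n+\frac{k^2}{4}}$ and \[ B^+=\left(\begin{array}{ccc|c} & & & k_{x_0}\\ & B & & \vdots\\ & & & k_{x_r}\\ \hline 1 & \ldots & 1 & 0 \end{array}\right), \] with rows and columns indexed by $x_0,\ldots,x_r,a_1$. Let $B^*$ be defined by $(B^* )^{\top}=D_\nu B^+D_\nu^{-1}$, and let $h_{x}=\mathbf{H}(T(B^+)_{-x_0})_x$ and $h'_x=\mathbf{H}(\frac{1}{\lambda_1}(B^* )^{\top}_{-x_0})_x$. Then, for all distinct vertices $u,v$ of the cone graph $G^+$, \begin{align*} H(G^+;(v,u))&=\begin{cases} k+1 & \text{if } v=a,\\ h_{f^+(v,u)} & \text{otherwise}, \end{cases}\\ H_m(G^+;(v,u))&=\begin{cases} \frac{\lambda_1^2}{n} & \text{if } v=a,\\ h'_{f^+(v,u)} & \text{otherwise.} \end{cases} \end{align*}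
   Context: The graph $G$ is finite, connected and undirected, with vertex set $V$. The cone graph $G^+$ over $G$ has vertex set $V\cup\{a\}$ with an additional vertex $a$, and its edges are those of $G$ together with $\{a,v\}$ for all $v\in V$. For a nonnegative square matrix $M=(m_{ij})$, $T(M)$ is the matrix with $(i,j)$-entry $m_{ij}/\sum_l m_{lj}$, read as the transition probability from $j$ to $i$. $M_{-x}$ is $M$ with the row and column indexed by $x$ removed (remaining indices keep their names; $(B^* )^\top_{-x_0}$ means $((B^* )^\top)_{-x_0}$), and $\mathbf{H}(M)=-\mathbf{1}(M-I)^{-1}$ with $\mathbf{1}$ the all-one row vector; $\mathbf{H}(M)_x$ is its entry indexed by $x$. For a graph $K$ with adjacency matrix $A_K$ and Perron eigenvector $\nu$ (positive unit eigenvector for the largest eigenvalue), the simple random walk has transition matrix $T(A_K)$ and the maximal entropy random walk has transition matrix $T(\mathrm{diag}(\nu)A_K)$. $H(K;(v,u))$ and $H_m(K;(v,u))$ are the expected numbers of steps needed by the simple, respectively maximal entropy, random walk started at $u$ to reach $v$ for the first time. A partition $\{V_0,\ldots,V_m\}$ of $V$ is equitable if for all $i,j$ the number of neighbours in $V_i$ of a vertex $w\in V_j$ is the same number $b_{ij}$ for all $w\in V_j$; $(b_{ij})$ is its quotient matrix. $G$ is $f$-equitable, for a function $f:V\times V\to\{x_0,x_1,\ldots,x_r\}$, if, writing $F_{x}(o)=\{u\in V: f(o,u)=x\}$, for every $o\in V$: $F_{x_0}(o)=\{o\}$; the partition $P_o=\{F_{x_0}(o),\ldots,F_{x_r}(o)\}$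 is equitable; and the quotient matrix of $P_o$, with the block $F_{x_i}(o)$ indexed by $x_i$, is the same matrix $B$ for every $o$. Then $k_{x_i}=|F_{x_i}(v)|$, which does not depend on $v\in V$. Let $a_0,a_1$ be two distinct values not in the image of $f$. The function $f^+$ on pairs of vertices of $G^+$ is $f^+(v,u)=f(v,u)$ if $u\ne a$ and $v\ne a$; $f^+(a,a)=a_0$; and $f^+(v,u)=a_1$ otherwise. $D_\nu$ is the diagonal matrix indexed by $x_0,\ldots,x_r,a_1$ whose entries are the values of the Perron eigenvector $\nu$ of $G^+$ on the corresponding blocks (for a vertex $v\in V$, the blocks are $F_{x_i}(v)$, and $\{a\}$ for $a_1$); up to a common positive scalar, $\nu$ equals $1$ on every vertex of $V$ and $\lambda_1-k$ on $a$. *)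

theory Defs
  imports "HOL-Probability.Probability" "Graph_Theory.Graph_Theory"
begin

section \<open>Square matrices indexed by a finite set of names\<close>

text \<open>
  A square matrix is a function \<open>M\<close> together with its index set \<open>I\<close>; only the
  entries \<open>M i j\<close> with \<open>i, j \<in> I\<close> matter.  Removing the row and the column of
  \<open>x\<close> amounts to replacing \<open>I\<close> by \<open>I - {x}\<close>, so the remaining indices keep
  their names.
\<close>

type_synonym 'i smat = "'i \<Rightarrow> 'i \<Rightarrow> real"

definition id_smat :: "'i smat" where
  "id_smat i j = (if i = j then 1 else 0)"

definition diag_smat :: "('i \<Rightarrow> real) \<Rightarrow> 'i smat" where
  "diag_smat d i j = (if i = j then d i else 0)"

definition transp_smat :: "'i smat \<Rightarrow> 'i smat" where
  "transp_smat M i j = M j i"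

definition mult_smat :: "'i set \<Rightarrow> 'i smat \<Rightarrow> 'i smat \<Rightarrow> 'i smat" where
  "mult_smat I M N i j = (\<Sum>l\<in>I. M i l * N l j)"

definition is_inv_smat :: "'i set \<Rightarrow> 'i smat \<Rightarrow> 'i smat \<Rightarrow> bool" where
  "is_inv_smat I M N \<longleftrightarrow> (\<forall>i\<in>I. \<forall>j\<in>I.
     mult_smat I M N i j = id_smat i j \<and> mult_smat I N M i j = id_smat i j)"

text \<open>The entries outside \<open>I \<times> I\<close> are set to \<open>0\<close> only to make the inverse unique as a function.\<close>

definition inv_smat :: "'i set \<Rightarrow> 'i smat \<Rightarrow> 'i smat" where
  "inv_smat I M = (THE N. is_inv_smat I M N \<and> (\<forall>i j. i \<notin> I \<or> j \<notin> I \<longrightarrow> N i j = 0))"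

definition eigenvalue_smat :: "'i set \<Rightarrow> 'i smat \<Rightarrow> real \<Rightarrow> bool" where
  "eigenvalue_smat I M \<mu> \<longleftrightarrow>
     (\<exists>x. (\<exists>i\<in>I. x i \<noteq> 0) \<and> (\<forall>i\<in>I. (\<Sum>j\<in>I. M i j * x j) = \<mu> * x i))"

definition T_smat :: "'i set \<Rightarrow> 'i smat \<Rightarrow> 'i smat" where
  "T_smat I M i j = M i j / (\<Sum>l\<in>I. M l j)"

text \<open>The row vector \<open>- 1 (M - I)\<^sup>-\<^sup>1\<close>, where \<open>1\<close> is the all-one row vector.\<close>

definition H_vec :: "'i set \<Rightarrow> 'i smat \<Rightarrow> 'i \<Rightarrow> real" where
  "H_vec I M x = - (\<Sum>i\<in>I. 1 * inv_smat I (\<lambda>i j. M i j - id_smat i j) i x)"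


section \<open>Random walks and expected hitting times\<close>

text \<open>
  \<open>P i j\<close> is the probability of a step from \<open>j\<close> to \<open>i\<close>, so the columns of \<open>P\<close>
  (restricted to the finite state set \<open>S\<close>) are the step distributions.
\<close>

definition step_pmf :: "'s set \<Rightarrow> 's smat \<Rightarrow> 's \<Rightarrow> 's pmf" where
  "step_pmf S P j = embed_pmf (\<lambda>i. if i \<in> S then P i j else 0)"

definition walk_kernel :: "'s set \<Rightarrow> 's smat \<Rightarrow> 's \<Rightarrow> nat \<Rightarrow> (nat \<Rightarrow> 's) \<Rightarrow> 's measure" where
  "walk_kernel S P u n \<omega> =
     measure_pmf (if n = 0 then return_pmf u else step_pmf S P (\<omega> (n - 1)))"

lemma Ionescu_Tulcea_walk_kernel:
  "Ionescu_Tulcea (walk_kernel S P u) (\<lambda>_. count_space UNIV)"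
proof (rule Ionescu_Tulcea.intro)
  fix n :: nat
  let ?N = "PiM {0..<n} (\<lambda>_. count_space (UNIV :: 'a set))"
  show "walk_kernel S P u n \<in> measurable ?N (subprob_algebra (count_space UNIV))"
  proof (cases "n = 0")
    case True
    then have "walk_kernel S P u n = (\<lambda>_. measure_pmf (return_pmf u))"
      by (simp only: walk_kernel_def fun_eq_iff if_True simp_thms)
    then show ?thesis
      by (simp only: measurable_const measure_pmf_in_subprob_algebra)
  next
    case False
    have step: "(\<lambda>j. measure_pmf (step_pmf S P j)) \<in>
        measurable (count_space UNIV) (subprob_algebra (count_space UNIV))"
      by (simp only: measurable_count_space_eq1 Pi_iff measure_pmf_in_subprob_algebra ball_triv simp_thms)
    have proj: "(\<lambda>\<omega>. \<omega> (n - 1)) \<in> measurable ?N (count_space UNIV)"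
      using False by (intro measurable_component_singleton) simp
    have "walk_kernel S P u n = (\<lambda>\<omega>. measure_pmf (step_pmf S P (\<omega> (n - 1))))"
      using False by (simp only: walk_kernel_def fun_eq_iff if_False simp_thms)
    then show ?thesis
      using measurable_compose [OF proj step] by (simp only:)
  qed
next
  fix n :: nat and \<omega> :: "nat \<Rightarrow> 'a"
  assume "\<omega> \<in> space (PiM {0..<n} (\<lambda>_. count_space UNIV))"
  show "prob_space (walk_kernel S P u n \<omega>)"
    by (simp only: walk_kernel_def measure_pmf.prob_space_axioms)
qed

text \<open>
  The law, on the space of all trajectories, of the Markov chain with transition
  matrix \<open>P\<close> started at \<open>u\<close> (Ionescu-Tulcea construction).
\<close>

definition walk_measure :: "'s set \<Rightarrow> 's smat \<Rightarrow> 's \<Rightarrow> (nat \<Rightarrow> 's) measure" where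
  "walk_measure S P u = projective_family.lim UNIV
     (Ionescu_Tulcea.CI (walk_kernel S P u) (\<lambda>_. count_space UNIV)) (\<lambda>_. count_space UNIV)"

text \<open>The first visit to \<open>v\<close>; it is \<open>\<infinity>\<close> on trajectories that never reach \<open>v\<close>.\<close>

definition first_visit :: "'s \<Rightarrow> (nat \<Rightarrow> 's) \<Rightarrow> enat" where
  "first_visit v \<omega> = (INF n\<in>{n. \<omega> n = v}. enat n)"

definition expected_hitting_time :: "'s set \<Rightarrow> 's smat \<Rightarrow> 's \<Rightarrow> 's \<Rightarrow> ennreal" where
  "expected_hitting_time S P v u =
     (\<integral>\<^sup>+ \<omega>. ennreal_of_enat (first_visit v \<omega>) \<partial>walk_measure S P u)"


section \<open>Simple and maximal entropy random walks on graphs\<close>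

definition adj_smat :: "'a pair_pre_digraph \<Rightarrow> 'a smat" where
  "adj_smat K i j = (if (i, j) \<in> parcs K then 1 else 0)"

definition is_perron_vector :: "'a pair_pre_digraph \<Rightarrow> ('a \<Rightarrow> real) \<Rightarrow> bool" where
  "is_perron_vector K \<nu> \<longleftrightarrow>
     (\<forall>v\<in>pverts K. \<nu> v > 0) \<and> (\<Sum>v\<in>pverts K. (\<nu> v)\<^sup>2) = 1 \<and>
     (\<exists>\<theta>. eigenvalue_smat (pverts K) (adj_smat K) \<theta> \<and>
          (\<forall>\<mu>. eigenvalue_smat (pverts K) (adj_smat K) \<mu> \<longrightarrow> \<mu> \<le> \<theta>) \<and>
          (\<forall>i\<in>pverts K. (\<Sum>j\<in>pverts K. adj_smat K i j * \<nu> j) = \<theta> * \<nu> i))"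

definition perron_vector :: "'a pair_pre_digraph \<Rightarrow> 'a \<Rightarrow> real" where
  "perron_vector K = (THE \<nu>. is_perron_vector K \<nu> \<and> (\<forall>v. v \<notin> pverts K \<longrightarrow> \<nu> v = 0))"

text \<open>\<open>H_srw K v u\<close> and \<open>H_merw K v u\<close>: the walk starts at \<open>u\<close> and is to reach \<open>v\<close>.\<close>

definition H_srw :: "'a pair_pre_digraph \<Rightarrow> 'a \<Rightarrow> 'a \<Rightarrow> ennreal" where
  "H_srw K v u = expected_hitting_time (pverts K) (T_smat (pverts K) (adj_smat K)) v u"

definition H_merw :: "'a pair_pre_digraph \<Rightarrow> 'a \<Rightarrow> 'a \<Rightarrow> ennreal" where
  "H_merw K v u = expected_hitting_time (pverts K)
     (T_smat (pverts K)
       (mult_smat (pverts K) (diag_smat (perron_vector K)) (adj_smat K))) v u"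


section \<open>Equitable partitions and equitable functions\<close>

definition nbrs :: "'a pair_pre_digraph \<Rightarrow> 'a \<Rightarrow> 'a set" where
  "nbrs K w = {u. (u, w) \<in> parcs K}"

definition equitable_partition :: "'a pair_pre_digraph \<Rightarrow> 'a set set \<Rightarrow> bool" where
  "equitable_partition K Q \<longleftrightarrow> partition_on (pverts K) Q \<and>
     (\<forall>C\<in>Q. \<forall>E\<in>Q. \<exists>b. \<forall>w\<in>E. card (nbrs K w \<inter> C) = b)"

definition is_quotient_matrix ::
    "'a pair_pre_digraph \<Rightarrow> 'x set \<Rightarrow> ('x \<Rightarrow> 'a set) \<Rightarrow> 'x smat \<Rightarrow> bool" where
  "is_quotient_matrix K X C B \<longleftrightarrow>
     (\<forall>i\<in>X. \<forall>j\<in>X. \<forall>w\<in>C j. real (card (nbrs K w \<inter> C i)) = B i j)"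

definition fibre :: "'a set \<Rightarrow> ('a \<Rightarrow> 'a \<Rightarrow> 'x) \<Rightarrow> 'x \<Rightarrow> 'a \<Rightarrow> 'a set" where
  "fibre V f x w = {u \<in> V. f w u = x}"

text \<open>
  \<open>X\<close> is the set \<open>{x\<^sub>0, \<dots>, x\<^sub>r}\<close>.  Since a partition has no empty blocks, \<open>X\<close> is
  the image of \<open>f\<close> and distinct indices belong to distinct blocks.
\<close>

definition f_equitable ::
    "'a pair_pre_digraph \<Rightarrow> ('a \<Rightarrow> 'a \<Rightarrow> 'x) \<Rightarrow> 'x set \<Rightarrow> 'x \<Rightarrow> 'x smat \<Rightarrow> bool" where
  "f_equitable K f X x0 B \<longleftrightarrow>
     finite X \<and> x0 \<in> X \<and> (\<forall>v\<in>pverts K. \<forall>u\<in>pverts K. f v u \<in> X) \<and>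
     (\<forall>w\<in>pverts K.
        fibre (pverts K) f x0 w = {w} \<and>
        equitable_partition K ((\<lambda>x. fibre (pverts K) f x w) ` X) \<and>
        is_quotient_matrix K X (\<lambda>x. fibre (pverts K) f x w) B)"

definition fibre_size :: "'a set \<Rightarrow> ('a \<Rightarrow> 'a \<Rightarrow> 'x) \<Rightarrow> 'x \<Rightarrow> nat" where
  "fibre_size V f x = (THE m. \<forall>v\<in>V. card (fibre V f x v) = m)"


section \<open>Cone graphs\<close>

definition cone_graph :: "'a pair_pre_digraph \<Rightarrow> 'a \<Rightarrow> 'a pair_pre_digraph" where
  "cone_graph K a = \<lparr> pverts = insert a (pverts K),
                parcs = parcs K \<union> {a} \<times> pverts K \<union> pverts K \<times> {a} \<rparr>"

definition cone_fun :: "'a \<Rightarrow> 'x \<Rightarrow> 'x \<Rightarrow> ('a \<Rightarrow> 'a \<Rightarrow> 'x) \<Rightarrow> 'a \<Rightarrow> 'a \<Rightarrow> 'x" where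
  "cone_fun a a0 a1 f v u =
     (if u \<noteq> a \<and> v \<noteq> a then f v u else if v = a \<and> u = a then a0 else a1)"

definition cone_smat :: "'x \<Rightarrow> ('x \<Rightarrow> nat) \<Rightarrow> 'x smat \<Rightarrow> 'x smat" where
  "cone_smat a1 kx B i j =
     (if i = a1 then (if j = a1 then 0 else 1)
      else if j = a1 then real (kx i) else B i j)"

text \<open>
  The value of \<open>\<nu>\<close> on the block with index \<open>x\<close>.  For \<open>v \<in> V\<close> the fibres of
  \<open>cone_fun a a0 a1 f v\<close> are those of \<open>f v\<close> together with \<open>{a}\<close>, which has index \<open>a1\<close>.
\<close>

definition block_value ::
    "'a pair_pre_digraph \<Rightarrow> 'a \<Rightarrow> ('a \<Rightarrow> 'a \<Rightarrow> 'x) \<Rightarrow> ('a \<Rightarrow> real) \<Rightarrow> 'x \<Rightarrow> real" where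
  "block_value K a fp \<nu> x =
     (THE c. \<forall>v\<in>pverts K. \<forall>u\<in>fibre (pverts (cone_graph K a)) fp x v. \<nu> u = c)"

end

theory Submission
  imports Defs
begin

text \<open>
  Let \<open>v\<close> be a vertex of \<open>G\<close>.  The expected time to hit \<open>v\<close> is the sum over \<open>t\<close> of the
  probability of not having met \<open>v\<close> up to time \<open>t\<close>, and these probabilities are the entries
  of \<open>1 Q\<^sup>t\<close>, where \<open>Q\<close> is the transition matrix with the row and column of \<open>v\<close> removed
  (\<open>expected_hitting_time_eq_suminf_survival\<close>).  On the other side \<open>H_vec\<close> of a nonnegative
  matrix \<open>M\<close> is, by the Neumann series for \<open>(I - M)\<^sup>-\<^sup>1\<close>, the sum over \<open>t\<close> of \<open>1 M\<^sup>t\<close>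
  (\<open>H_vec_eq_suminf_survival\<close>).  So it suffices to compare \<open>1 Q\<^sup>t\<close> with \<open>1 M\<^sup>t\<close> for
  every \<open>t\<close>, where \<open>M\<close> is the matrix on the blocks with the index \<open>x0\<close> removed.  They agree because
  the equitable partition around \<open>v\<close>, with the apex as a further block, lumps the walk
  (\<open>survival_lump\<close>, \<open>cone_step_lumps\<close>).  Convergence follows from an explicit
  superharmonic function (\<open>survival_cone_step_summable\<close>).

  The two random walks are handled together.  The Perron eigenvector of the cone over a
  \<open>k\<close>-regular graph is constant on \<open>G\<close>, with ratio \<open>\<lambda>\<^sub>1 - k\<close> between the apex and \<open>G\<close>
  (\<open>perron_vector_cone\<close>), so both walks move from a vertex of \<open>G\<close> to the apex with a fixed
  probability \<open>p\<close>, to each neighbour in \<open>G\<close> with a fixed probability \<open>q\<close>, and from the apex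
  to a uniform vertex.  Here \<open>p = q = 1 / (k + 1)\<close> for the simple walk, and
  \<open>p = (\<lambda>\<^sub>1 - k) / \<lambda>\<^sub>1\<close>, \<open>q = 1 / \<lambda>\<^sub>1\<close> for the maximal entropy walk.  When the apex is the
  target, the hitting time is geometric with mean \<open>1 / p\<close>; for the maximal entropy walk
  \<open>\<lambda>\<^sub>1 (\<lambda>\<^sub>1 - k) = n\<close> turns this into \<open>\<lambda>\<^sub>1\<^sup>2 / n\<close>.

  That the block sizes \<open>k\<^sub>x\<close> do not depend on the base vertex is where connectedness of
  \<open>G\<close> enters (\<open>card_fibre_indep\<close>).
\<close>

section \<open>Inverses and diagonal matrices\<close>

lemma inv_smat_eqI:
  assumes fin: "finite I" and inv: "is_inv_smat I A N" and ij: "i \<in> I" "j \<in> I"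
  shows "inv_smat I A i j = N i j"
proof -
  define N' where "N' = (\<lambda>i j. if i \<in> I \<and> j \<in> I then N i j else 0)"
  have N': "is_inv_smat I A N' \<and> (\<forall>i j. i \<notin> I \<or> j \<notin> I \<longrightarrow> N' i j = 0)"
    using inv by (simp add: is_inv_smat_def mult_smat_def N'_def)
  have "inv_smat I A = N'"
    unfolding inv_smat_def
  proof (rule the_equality)
    show "is_inv_smat I A N' \<and> (\<forall>i j. i \<notin> I \<or> j \<notin> I \<longrightarrow> N' i j = 0)"
      by (rule N')
  next
    fix R assume R: "is_inv_smat I A R \<and> (\<forall>i j. i \<notin> I \<or> j \<notin> I \<longrightarrow> R i j = 0)"
    show "R = N'"
    proof (intro ext)
      fix i j
      show "R i j = N' i j"
      proof (cases "i \<in> I \<and> j \<in> I")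
        case True
        have "R i j = (\<Sum>l\<in>I. R i l * id_smat l j)"
          using True fin by (simp add: id_smat_def if_distrib sum.delta cong: if_cong)
        also have "\<dots> = (\<Sum>l\<in>I. R i l * (\<Sum>m\<in>I. A l m * N' m j))"
          using True N' by (intro sum.cong refl) (simp add: is_inv_smat_def mult_smat_def)
        also have "\<dots> = (\<Sum>m\<in>I. (\<Sum>l\<in>I. R i l * A l m) * N' m j)"
          unfolding sum_distrib_left sum_distrib_right mult.assoc
          by (rule sum.swap)
        also have "\<dots> = (\<Sum>m\<in>I. id_smat i m * N' m j)"
          using True R by (intro sum.cong refl) (simp add: is_inv_smat_def mult_smat_def)
        also have "\<dots> = (\<Sum>m\<in>I. if i = m then N' m j else 0)"
          by (intro sum.cong) (simp_all add: id_smat_def)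
        also have "\<dots> = N' i j"
          using True fin by simp
        finally show ?thesis .
      next
        case False
        then show ?thesis using R N' by metis
      qed
    qed
  qed
  then show ?thesis using ij by (simp add: N'_def)
qed

lemma mult_diag_smat_left:
  assumes "finite I" "i \<in> I"
  shows "mult_smat I (diag_smat d) M i j = d i * M i j"
proof -
  have "mult_smat I (diag_smat d) M i j = (\<Sum>l\<in>I. if i = l then d i * M i j else 0)"
    unfolding mult_smat_def by (intro sum.cong) (auto simp: diag_smat_def)
  then show ?thesis using assms by simp
qed

lemma mult_diag_smat_right:
  assumes "finite I" "j \<in> I"
  shows "mult_smat I M (diag_smat d) i j = M i j * d j"
proof -
  have "mult_smat I M (diag_smat d) i j = (\<Sum>l\<in>I. if l = j then M i j * d j else 0)"
    unfolding mult_smat_def by (intro sum.cong) (auto simp: diag_smat_def)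
  then show ?thesis using assms by simp
qed

lemma inv_diag_smat:
  assumes fin: "finite I" and d: "\<And>i. i \<in> I \<Longrightarrow> d i \<noteq> 0" and ij: "i \<in> I" "j \<in> I"
  shows "inv_smat I (diag_smat d) i j = diag_smat (\<lambda>i. 1 / d i) i j"
proof (rule inv_smat_eqI[OF fin _ ij])
  show "is_inv_smat I (diag_smat d) (diag_smat (\<lambda>i. 1 / d i))"
    unfolding is_inv_smat_def
  proof (intro ballI conjI)
    fix i j assume ij: "i \<in> I" "j \<in> I"
    show "mult_smat I (diag_smat d) (diag_smat (\<lambda>i. 1 / d i)) i j = id_smat i j"
      unfolding mult_diag_smat_left[OF fin ij(1)] using d ij by (simp add: diag_smat_def id_smat_def)
    show "mult_smat I (diag_smat (\<lambda>i. 1 / d i)) (diag_smat d) i j = id_smat i j"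
      unfolding mult_diag_smat_left[OF fin ij(1)] using d ij by (simp add: diag_smat_def id_smat_def)
  qed
qed

section \<open>Neumann series and survival probabilities\<close>

text \<open>
  The row vector \<open>1 M\<^sup>t\<close>.  When \<open>M\<close> is a transition matrix from which the index of a target
  has been removed, its entry at \<open>x\<close> is the probability that the chain started at \<open>x\<close> has
  not met the target up to time \<open>t\<close>, hence the name.
\<close>

primrec survival :: "'i set \<Rightarrow> 'i smat \<Rightarrow> nat \<Rightarrow> 'i \<Rightarrow> real" where
  "survival I M 0 x = 1"
| "survival I M (Suc t) x = (\<Sum>i\<in>I. survival I M t i * M i x)"

lemma survival_cong:
  assumes "\<And>i j. i \<in> I \<Longrightarrow> j \<in> I \<Longrightarrow> M i j = N i j" "x \<in> I"
  shows "survival I M t x = survival I N t x"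
  using assms(2) by (induction t arbitrary: x) (simp_all add: assms(1))

lemma survival_nonneg:
  assumes "\<And>i j. i \<in> I \<Longrightarrow> j \<in> I \<Longrightarrow> 0 \<le> M i j" "x \<in> I"
  shows "0 \<le> survival I M t x"
  using assms(2) by (induction t arbitrary: x) (auto intro!: sum_nonneg mult_nonneg_nonneg assms(1))

text \<open>
  The hypothesis says that \<open>\<phi>\<close> lumps the chain: the mass that \<open>P\<close> sends from \<open>u\<close> into a
  class depends only on the class of \<open>u\<close>.  A row vector that is constant on the classes then
  stays so under multiplication by \<open>P\<close>, and the all-one vector is such a vector.
\<close>

lemma survival_lump:
  assumes fin: "finite J" "finite I"
    and maps: "\<And>w. w \<in> J \<Longrightarrow> \<phi> w \<in> I"
    and lump: "\<And>i u. i \<in> I \<Longrightarrow> u \<in> J \<Longrightarrow> (\<Sum>w | w \<in> J \<and> \<phi> w = i. P w u) = M i (\<phi> u)"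
    and u: "u \<in> J"
  shows "survival J P t u = survival I M t (\<phi> u)"
  using u
proof (induction t arbitrary: u)
  case (Suc t)
  have "survival J P (Suc t) u = (\<Sum>w\<in>J. survival I M t (\<phi> w) * P w u)"
    using Suc.IH by simp
  also have "\<dots> = (\<Sum>i\<in>I. \<Sum>w | w \<in> J \<and> \<phi> w = i. survival I M t (\<phi> w) * P w u)"
    using fin maps by (intro sum.group[symmetric]) auto
  also have "\<dots> = (\<Sum>i\<in>I. survival I M t i * (\<Sum>w | w \<in> J \<and> \<phi> w = i. P w u))"
    unfolding sum_distrib_left by (intro sum.cong refl) auto
  also have "\<dots> = survival I M (Suc t) (\<phi> u)"
    using lump Suc.prems by simp
  finally show ?case .
qed simp

text \<open>
  Summing \<open>g \<ge> 1 + g M\<close> over time bounds every partial sum of the survival probabilities by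
  \<open>g\<close>.  An upper bound for the hitting times that satisfies this inequality is enough, so
  the equation itself never has to be solved.
\<close>

lemma survival_summable:
  assumes fin: "finite I"
    and nonneg: "\<And>i j. i \<in> I \<Longrightarrow> j \<in> I \<Longrightarrow> 0 \<le> M i j"
    and g0: "\<And>i. i \<in> I \<Longrightarrow> 0 \<le> g i"
    and super: "\<And>x. x \<in> I \<Longrightarrow> 1 + (\<Sum>i\<in>I. g i * M i x) \<le> g x"
    and x: "x \<in> I"
  shows "summable (\<lambda>t. survival I M t x)"
proof (rule bounded_imp_summable)
  show "0 \<le> survival I M t x" for t
    using survival_nonneg[OF nonneg x] .
  have "(\<Sum>t<n. survival I M t x) \<le> g x" for n
    using x
  proof (induction n arbitrary: x)
    case (Suc n)
    have "(\<Sum>t<Suc n. survival I M t x) = 1 + (\<Sum>i\<in>I. (\<Sum>t<n. survival I M t i) * M i x)"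
      unfolding sum.lessThan_Suc_shift sum_distrib_right by (simp add: sum.swap[of _ I])
    also have "\<dots> \<le> 1 + (\<Sum>i\<in>I. g i * M i x)"
      using Suc by (intro add_left_mono sum_mono mult_right_mono nonneg) auto
    also have "\<dots> \<le> g x"
      using super Suc.prems .
    finally show ?case .
  qed (simp add: g0)
  from this[of "Suc _"] show "(\<Sum>t\<le>n. survival I M t x) \<le> g x" for n
    by (simp add: lessThan_Suc_atMost)
qed

primrec smat_power :: "'i set \<Rightarrow> 'i smat \<Rightarrow> nat \<Rightarrow> 'i smat" where
  "smat_power I M 0 = id_smat"
| "smat_power I M (Suc t) = mult_smat I (smat_power I M t) M"

lemma smat_power_Suc_left:
  assumes "finite I" "i \<in> I" "j \<in> I"
  shows "smat_power I M (Suc t) i j = (\<Sum>l\<in>I. M i l * smat_power I M t l j)"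
  using assms(3)
proof (induction t arbitrary: j)
  case 0
  have "(\<Sum>l\<in>I. id_smat i l * M l j) = (\<Sum>l\<in>I. if i = l then M l j else 0)"
    by (intro sum.cong) (simp_all add: id_smat_def)
  moreover have "(\<Sum>l\<in>I. M i l * id_smat l j) = (\<Sum>l\<in>I. if l = j then M i l else 0)"
    by (intro sum.cong) (simp_all add: id_smat_def)
  ultimately show ?case
    using assms 0 by (simp add: mult_smat_def)
next
  case (Suc t)
  have "smat_power I M (Suc (Suc t)) i j = (\<Sum>m\<in>I. smat_power I M (Suc t) i m * M m j)"
    by (simp add: mult_smat_def)
  also have "\<dots> = (\<Sum>m\<in>I. (\<Sum>l\<in>I. M i l * smat_power I M t l m) * M m j)"
    using Suc.IH by (intro sum.cong refl) simp
  also have "\<dots> = (\<Sum>l\<in>I. M i l * smat_power I M (Suc t) l j)"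
    unfolding smat_power.simps mult_smat_def sum_distrib_left sum_distrib_right mult.assoc
    by (rule sum.swap)
  finally show ?case .
qed

lemma survival_eq_colsum_power:
  assumes "finite I" "x \<in> I"
  shows "survival I M t x = (\<Sum>i\<in>I. smat_power I M t i x)"
  using assms(2)
proof (induction t arbitrary: x)
  case 0
  then show ?case using assms(1) by (simp add: id_smat_def)
next
  case (Suc t)
  have "survival I M (Suc t) x = (\<Sum>l\<in>I. \<Sum>i\<in>I. smat_power I M t i l * M l x)"
    using Suc.IH by (simp add: sum_distrib_right)
  also have "\<dots> = (\<Sum>i\<in>I. smat_power I M (Suc t) i x)"
    unfolding smat_power.simps mult_smat_def by (rule sum.swap)
  finally show ?case .
qed

text \<open>
  The survival vector is the vector of column sums of \<open>M\<^sup>t\<close>.  Since \<open>M\<close> is nonnegative, each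
  entry of \<open>M\<^sup>t\<close> is dominated by its column sum, so summability of the survival probabilities
  makes \<open>\<Sum>t. M\<^sup>t\<close> converge entrywise; it is then a two-sided inverse of \<open>I - M\<close>, and
  \<open>H_vec\<close> becomes the sum of the survival probabilities over time.
\<close>

lemma H_vec_eq_suminf_survival:
  assumes fin: "finite I"
    and nonneg: "\<And>i j. i \<in> I \<Longrightarrow> j \<in> I \<Longrightarrow> 0 \<le> M i j"
    and summ: "\<And>x. x \<in> I \<Longrightarrow> summable (\<lambda>t. survival I M t x)"
    and x: "x \<in> I"
  shows "H_vec I M x = (\<Sum>t. survival I M t x)"
proof -
  let ?p = "\<lambda>t. smat_power I M t"
  have pos: "0 \<le> ?p t i j" if "i \<in> I" "j \<in> I" for t i j
    using that(2)
    by (induction t arbitrary: j)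
      (auto simp: id_smat_def mult_smat_def that(1) intro!: sum_nonneg mult_nonneg_nonneg nonneg)
  have sump: "summable (\<lambda>t. ?p t i j)" if ij: "i \<in> I" "j \<in> I" for i j
  proof (rule summable_comparison_test'[OF summ[OF ij(2)]])
    fix t
    have "?p t i j \<le> (\<Sum>i\<in>I. ?p t i j)"
      using fin ij pos by (intro member_le_sum) auto
    then show "norm (?p t i j) \<le> survival I M t j"
      using fin ij pos by (simp add: survival_eq_colsum_power)
  qed
  define R where "R i j = (\<Sum>t. ?p t i j)" for i j
  have R_split: "R i j = id_smat i j + (\<Sum>t. ?p (Suc t) i j)" if "i \<in> I" "j \<in> I" for i j
    unfolding R_def using suminf_split_head[OF sump[OF that]] by simp
  have "is_inv_smat I (\<lambda>i j. M i j - id_smat i j) (\<lambda>i j. - R i j)"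
    unfolding is_inv_smat_def
  proof (intro ballI conjI)
    fix i j assume ij: "i \<in> I" "j \<in> I"
    have "(\<Sum>t. ?p (Suc t) i j) = (\<Sum>t. \<Sum>l\<in>I. M i l * ?p t l j)"
      using smat_power_Suc_left[OF fin ij] by simp
    also have "\<dots> = (\<Sum>l\<in>I. M i l * R l j)"
      unfolding R_def using ij sump
      by (subst suminf_sum) (auto intro!: sum.cong suminf_mult summable_mult)
    finally have "R i j = id_smat i j + (\<Sum>l\<in>I. M i l * R l j)"
      using R_split[OF ij] by simp
    moreover have "(\<Sum>l\<in>I. id_smat i l * R l j) = (\<Sum>l\<in>I. if i = l then R l j else 0)"
      by (intro sum.cong) (simp_all add: id_smat_def)
    ultimately show "mult_smat I (\<lambda>i j. M i j - id_smat i j) (\<lambda>i j. - R i j) i j = id_smat i j"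
      using fin ij by (simp add: mult_smat_def left_diff_distrib sum_subtractf sum_negf)
    have "(\<Sum>t. ?p (Suc t) i j) = (\<Sum>t. \<Sum>l\<in>I. ?p t i l * M l j)"
      by (simp add: mult_smat_def)
    also have "\<dots> = (\<Sum>l\<in>I. R i l * M l j)"
      unfolding R_def using ij sump
      by (subst suminf_sum) (auto intro!: sum.cong suminf_mult2[symmetric] summable_mult2)
    finally have "R i j = id_smat i j + (\<Sum>l\<in>I. R i l * M l j)"
      using R_split[OF ij] by simp
    moreover have "(\<Sum>l\<in>I. R i l * id_smat l j) = (\<Sum>l\<in>I. if l = j then R i l else 0)"
      by (intro sum.cong) (simp_all add: id_smat_def)
    ultimately show "mult_smat I (\<lambda>i j. - R i j) (\<lambda>i j. M i j - id_smat i j) i j = id_smat i j"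
      using fin ij by (simp add: mult_smat_def right_diff_distrib sum_subtractf sum_negf)
  qed
  then have "H_vec I M x = (\<Sum>i\<in>I. R i x)"
    using x by (simp add: H_vec_def inv_smat_eqI[OF fin] sum_negf)
  also have "\<dots> = (\<Sum>t. \<Sum>i\<in>I. ?p t i x)"
    unfolding R_def using x sump by (intro suminf_sum[symmetric]) auto
  also have "\<dots> = (\<Sum>t. survival I M t x)"
    using fin x by (simp add: survival_eq_colsum_power)
  finally show ?thesis .
qed

section \<open>Expected hitting times as sums of survival probabilities\<close>

lemma nn_integral_step_pmf:
  assumes fin: "finite S" and j: "j \<in> S"
    and nonneg: "\<And>i. i \<in> S \<Longrightarrow> 0 \<le> P i j" and stoch: "(\<Sum>i\<in>S. P i j) = 1"
  shows "(\<integral>\<^sup>+ y. g y \<partial>measure_pmf (step_pmf S P j)) = (\<Sum>i\<in>S. ennreal (P i j) * g i)"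
proof -
  let ?q = "\<lambda>i. if i \<in> S then P i j else 0"
  have "(\<integral>\<^sup>+ i. ennreal (?q i) \<partial>count_space UNIV) = (\<Sum>i\<in>S. ennreal (?q i))"
    using fin by (intro nn_integral_count_space') (auto)
  also have "\<dots> = ennreal (\<Sum>i\<in>S. P i j)"
    using nonneg by (simp add: sum_ennreal)
  finally have one: "(\<integral>\<^sup>+ i. ennreal (?q i) \<partial>count_space UNIV) = 1"
    using stoch by simp
  have pmf: "pmf (step_pmf S P j) i = ?q i" for i
    unfolding step_pmf_def using nonneg one by (subst pmf_embed_pmf) auto
  have "set_pmf (step_pmf S P j) \<subseteq> S"
    by (auto simp: set_pmf_eq pmf split: if_splits)
  then have "(\<integral>\<^sup>+ y. g y \<partial>measure_pmf (step_pmf S P j)) = (\<Sum>i\<in>S. g i * ennreal (pmf (step_pmf S P j) i))"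
    using fin by (intro nn_integral_measure_pmf_support) (auto simp: set_pmf_eq)
  also have "\<dots> = (\<Sum>i\<in>S. ennreal (P i j) * g i)"
    by (intro sum.cong) (simp_all add: pmf mult.commute)
  finally show ?thesis .
qed

text \<open>
  A time is the number of moments that strictly precede it.  This also covers the
  trajectories that never meet \<open>v\<close>, where both sides are infinite.
\<close>

lemma first_visit_suminf:
  "ennreal_of_enat (first_visit v \<omega>) = (\<Sum>t. indicator {\<omega>. \<forall>m\<le>t. \<omega> m \<noteq> v} \<omega>)"
proof (cases "\<exists>n. \<omega> n = v")
  case True
  define n where "n = (LEAST n. \<omega> n = v)"
  have n: "\<omega> n = v" and least: "\<And>m. \<omega> m = v \<Longrightarrow> n \<le> m"
    unfolding n_def using True by (auto intro: LeastI_ex Least_le)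
  have "first_visit v \<omega> = enat n"
    unfolding first_visit_def
  proof (rule antisym)
    show "(INF n\<in>{n. \<omega> n = v}. enat n) \<le> enat n"
      by (rule INF_lower) (simp add: n)
    show "enat n \<le> (INF n\<in>{n. \<omega> n = v}. enat n)"
      by (rule INF_greatest) (simp add: least)
  qed
  moreover have "(\<forall>m\<le>t. \<omega> m \<noteq> v) \<longleftrightarrow> t < n" for t
  proof
    show "t < n" if "\<forall>m\<le>t. \<omega> m \<noteq> v"
      using that n by (cases "t < n") auto
    show "\<forall>m\<le>t. \<omega> m \<noteq> v" if "t < n"
      using that least by force
  qed
  then have "(\<Sum>t. indicator {\<omega>. \<forall>m\<le>t. \<omega> m \<noteq> v} \<omega> :: ennreal) = (\<Sum>t. if t < n then 1 else 0)"
    by (intro suminf_cong) (simp add: indicator_def)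
  moreover have "(\<Sum>t. if t < n then 1 else 0 :: ennreal) = (\<Sum>t<n. if t < n then 1 else 0)"
    by (intro suminf_finite) auto
  ultimately show ?thesis by simp
next
  case False
  then have "first_visit v \<omega> = \<infinity>"
    by (simp add: first_visit_def top_enat_def)
  moreover have "(\<Sum>t. indicator {\<omega>. \<forall>m\<le>t. \<omega> m \<noteq> v} \<omega> :: ennreal) = (\<Sum>t. 1)"
    using False by (intro suminf_cong) simp
  moreover have "(\<Sum>t. 1 :: ennreal) = top"
  proof (rule ccontr)
    assume "(\<Sum>t. 1 :: ennreal) \<noteq> top"
    then obtain n where "(\<Sum>t. 1 :: ennreal) < of_nat n"
      using ennreal_Ex_less_of_nat[of "\<Sum>t. 1"] by (auto simp: less_top)
    moreover have "(\<Sum>t<n. 1 :: ennreal) \<le> (\<Sum>t. 1)"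
      by (rule sum_le_suminf) auto
    ultimately show False by simp
  qed
  ultimately show ?thesis by simp
qed

lemma sets_avoiding:
  fixes t :: nat
  assumes "{..t} \<subseteq> J"
  shows "{\<omega> \<in> space (PiM J (\<lambda>_. count_space UNIV)). \<forall>m\<le>t. \<omega> m \<noteq> v}
    \<in> sets (PiM J (\<lambda>_. count_space UNIV))" (is "_ \<in> sets ?N")
proof -
  have "{\<omega> \<in> space ?N. \<omega> m \<noteq> v} \<in> sets ?N" if "m \<le> t" for m
  proof -
    have "(\<lambda>\<omega>. \<omega> m) -` (- {v}) \<inter> space ?N \<in> sets ?N"
      using assms that by (intro measurable_sets[OF measurable_component_singleton]) auto
    also have "(\<lambda>\<omega>. \<omega> m) -` (- {v}) \<inter> space ?N = {\<omega> \<in> space ?N. \<omega> m \<noteq> v}"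
      by auto
    finally show ?thesis .
  qed
  then have "{\<omega> \<in> space ?N. \<forall>m\<in>{..t}. \<omega> m \<noteq> v} \<in> sets ?N"
    by (intro sets.sets_Collect_finite_All) auto
  then show ?thesis
    unfolding Ball_def atMost_iff .
qed

lemma borel_measurable_avoiding:
  fixes g :: "'s \<Rightarrow> ennreal" and t :: nat
  assumes "{..t} \<subseteq> J"
  shows "(\<lambda>\<omega>. indicator {\<omega>. \<forall>m\<le>t. \<omega> m \<noteq> v} \<omega> * g (\<omega> t))
    \<in> borel_measurable (PiM J (\<lambda>_. count_space UNIV))"
proof -
  have "(\<lambda>\<omega>. g (\<omega> t)) \<in> borel_measurable (PiM J (\<lambda>_. count_space UNIV))"
    using assms by (intro measurable_compose[OF measurable_component_singleton]) auto
  moreover have "(\<lambda>\<omega>. indicator {\<omega>. \<forall>m\<le>t. \<omega> m \<noteq> v} \<omega> :: ennreal)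
      \<in> borel_measurable (PiM J (\<lambda>_. count_space UNIV))"
    by (subst borel_measurable_indicator_iff) (use sets_avoiding[OF assms, of v] in \<open>simp only: Int_def mem_Collect_eq conj_commute\<close>)
  ultimately show ?thesis
    by (rule borel_measurable_times_ennreal[rotated])
qed

context
  fixes S :: "'s set" and P :: "'s smat" and v u :: 's
  assumes fin: "finite S"
    and nonneg: "\<And>i j. i \<in> S \<Longrightarrow> j \<in> S \<Longrightarrow> 0 \<le> P i j"
    and stoch: "\<And>j. j \<in> S \<Longrightarrow> (\<Sum>i\<in>S. P i j) = 1"
    and u: "u \<in> S" "u \<noteq> v"
begin

interpretation IT: Ionescu_Tulcea "walk_kernel S P u" "\<lambda>_. count_space UNIV"
  by (rule Ionescu_Tulcea_walk_kernel)

text \<open>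
  The induction on \<open>t\<close> peels off the last step of the trajectory, and integrating it out
  turns \<open>g\<close> into the function with one more step in it; this is why \<open>g\<close> and \<open>s\<close> vary.
  Only the values of \<open>g\<close> on \<open>S - {v}\<close> are prescribed: outside \<open>S\<close> the step distributions
  are meaningless, and fixing \<open>g\<close> there would require a separate proof that the chain stays
  in \<open>S\<close> almost surely.
\<close>

lemma nn_integral_C_avoiding:
  assumes "\<And>x. x \<in> S - {v} \<Longrightarrow> g x = ennreal (survival (S - {v}) P s x)"
  shows "(\<integral>\<^sup>+ \<omega>. indicator {\<omega>. \<forall>m\<le>t. \<omega> m \<noteq> v} \<omega> * g (\<omega> t) \<partial>IT.C 0 (Suc t) (\<lambda>_. undefined)) =
    ennreal (survival (S - {v}) P (s + t) u)"
  using assms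
proof (induction t arbitrary: g s)
  case 0
  have 1: "(\<lambda>\<omega>. indicator {\<omega>. \<forall>m\<le>0. \<omega> m \<noteq> v} \<omega> * g (\<omega> 0)) \<in>
      borel_measurable (PiM {0..<Suc 0} (\<lambda>_. count_space UNIV))"
    by (rule borel_measurable_avoiding) auto
  have "(\<integral>\<^sup>+ \<omega>. indicator {\<omega>. \<forall>m\<le>0. \<omega> m \<noteq> v} \<omega> * g (\<omega> 0) \<partial>IT.C 0 (Suc 0) (\<lambda>_. undefined)) =
      (\<integral>\<^sup>+ \<omega>. indicator {\<omega>. \<forall>m\<le>0. \<omega> m \<noteq> v} \<omega> * g (\<omega> 0) \<partial>IT.eP 0 (\<lambda>_. undefined))"
  proof -
    have "IT.C 0 (Suc 0) (\<lambda>_. undefined) = IT.eP 0 (\<lambda>_. undefined)"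
      unfolding IT.C.simps add_0_right
      by (rule bind_return[OF IT.measurable_eP]) (simp add: space_PiM)
    then show ?thesis by simp
  qed
  also have "\<dots> = (\<integral>\<^sup>+ y. indicator {y. y \<noteq> v} y * g y \<partial>measure_pmf (return_pmf u))"
    using 1 by (subst IT.nn_integral_eP) (auto simp: walk_kernel_def indicator_def space_PiM)
  also have "\<dots> = g u"
    using u by simp
  finally show ?case
    using 0 u by simp
next
  case (Suc t)
  let ?N = "\<lambda>t. PiM {0..<t} (\<lambda>_. count_space (UNIV :: 's set))"
  define g' where "g' x = (\<integral>\<^sup>+ y. indicator {y. y \<noteq> v} y * g y \<partial>measure_pmf (step_pmf S P x))" for x
  have 1: "(\<lambda>\<omega>. indicator {\<omega>. \<forall>m\<le>Suc t. \<omega> m \<noteq> v} \<omega> * g (\<omega> (Suc t))) \<in>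
      borel_measurable (?N (Suc (Suc t)))"
    by (rule borel_measurable_avoiding) auto
  have C: "sets (IT.C 0 (Suc t) (\<lambda>_. undefined)) = sets (?N (Suc t))"
    using IT.sets_C[of "\<lambda>_. undefined" 0 "Suc t"] by (simp add: space_PiM del: IT.C.simps)
  have eP: "IT.eP (Suc t) \<in> measurable (IT.C 0 (Suc t) (\<lambda>_. undefined)) (subprob_algebra (?N (Suc (Suc t))))"
    using IT.measurable_eP[of "Suc t"] unfolding measurable_cong_sets[OF C refl] .
  have "(\<integral>\<^sup>+ \<omega>. indicator {\<omega>. \<forall>m\<le>Suc t. \<omega> m \<noteq> v} \<omega> * g (\<omega> (Suc t)) \<partial>IT.C 0 (Suc (Suc t)) (\<lambda>_. undefined)) =
      (\<integral>\<^sup>+ \<omega>. (\<integral>\<^sup>+ \<omega>. indicator {\<omega>. \<forall>m\<le>Suc t. \<omega> m \<noteq> v} \<omega> * g (\<omega> (Suc t)) \<partial>IT.eP (Suc t) \<omega>)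
        \<partial>IT.C 0 (Suc t) (\<lambda>_. undefined))"
    unfolding IT.C.simps(2)[of 0 "Suc t"] add_0 by (rule nn_integral_bind[OF 1 eP])
  also have "\<dots> = (\<integral>\<^sup>+ \<omega>. indicator {\<omega>. \<forall>m\<le>t. \<omega> m \<noteq> v} \<omega> * g' (\<omega> t) \<partial>IT.C 0 (Suc t) (\<lambda>_. undefined))"
  proof (intro nn_integral_cong)
    fix \<omega> assume "\<omega> \<in> space (IT.C 0 (Suc t) (\<lambda>_. undefined))"
    then have \<omega>: "\<omega> \<in> space (?N (Suc t))"
      using IT.space_C[of "\<lambda>_. undefined" 0 "Suc t"] by (simp add: space_PiM del: IT.C.simps)
    have "(\<integral>\<^sup>+ \<omega>. indicator {\<omega>. \<forall>m\<le>Suc t. \<omega> m \<noteq> v} \<omega> * g (\<omega> (Suc t)) \<partial>IT.eP (Suc t) \<omega>) =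
        (\<integral>\<^sup>+ y. indicator {\<omega>. \<forall>m\<le>t. \<omega> m \<noteq> v} \<omega> * (indicator {y. y \<noteq> v} y * g y) \<partial>measure_pmf (step_pmf S P (\<omega> t)))"
    proof -
      have *: "(\<forall>m\<le>Suc t. (fun_upd \<omega> (Suc t) y) m \<noteq> v) \<longleftrightarrow> (\<forall>m\<le>t. \<omega> m \<noteq> v) \<and> y \<noteq> v" for y
      proof -
        have "(\<forall>m\<le>Suc t. (fun_upd \<omega> (Suc t) y) m \<noteq> v) \<longleftrightarrow>
            (\<forall>m\<le>t. (fun_upd \<omega> (Suc t) y) m \<noteq> v) \<and> (fun_upd \<omega> (Suc t) y) (Suc t) \<noteq> v"
          using le_Suc_eq[of _ t] by blast
        then show ?thesis by simp
      qed
      have "(\<integral>\<^sup>+ \<omega>. indicator {\<omega>. \<forall>m\<le>Suc t. \<omega> m \<noteq> v} \<omega> * g (\<omega> (Suc t)) \<partial>IT.eP (Suc t) \<omega>) =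
          (\<integral>\<^sup>+ y. indicator {\<omega>. \<forall>m\<le>Suc t. \<omega> m \<noteq> v} (fun_upd \<omega> (Suc t) y) * g ((fun_upd \<omega> (Suc t) y) (Suc t))
            \<partial>walk_kernel S P u (Suc t) \<omega>)"
        by (rule IT.nn_integral_eP[OF \<omega> 1])
      also have "walk_kernel S P u (Suc t) \<omega> = measure_pmf (step_pmf S P (\<omega> t))"
        by (simp add: walk_kernel_def)
      finally show ?thesis
        unfolding indicator_def mem_Collect_eq * of_bool_conj mult.assoc fun_upd_same .
    qed
    then show "(\<integral>\<^sup>+ \<omega>. indicator {\<omega>. \<forall>m\<le>Suc t. \<omega> m \<noteq> v} \<omega> * g (\<omega> (Suc t)) \<partial>IT.eP (Suc t) \<omega>) =
        indicator {\<omega>. \<forall>m\<le>t. \<omega> m \<noteq> v} \<omega> * g' (\<omega> t)"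
      by (simp add: nn_integral_cmult g'_def)
  qed
  also have "\<dots> = ennreal (survival (S - {v}) P (Suc s + t) u)"
  proof (rule Suc.IH)
    fix x assume x: "x \<in> S - {v}"
    have "g' x = (\<Sum>i\<in>S. ennreal (P i x) * (indicator {y. y \<noteq> v} i * g i))"
      unfolding g'_def using x by (intro nn_integral_step_pmf fin nonneg stoch) auto
    also have "\<dots> = (\<Sum>i\<in>S - {v}. ennreal (P i x) * g i)"
      using fin by (intro sum.mono_neutral_cong_right) auto
    also have "\<dots> = (\<Sum>i\<in>S - {v}. ennreal (survival (S - {v}) P s i * P i x))"
      using x Suc.prems nonneg by (intro sum.cong) (simp_all add: ennreal_mult' mult.commute)
    also have "\<dots> = ennreal (survival (S - {v}) P (Suc s) x)"
      using x nonneg by (subst sum_ennreal) (auto intro!: mult_nonneg_nonneg survival_nonneg)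
    finally show "g' x = ennreal (survival (S - {v}) P (Suc s) x)" .
  qed
  finally show ?case by simp
qed

text \<open>
  The tail formula \<open>E \<tau> = \<Sum>t. P(\<tau> > t)\<close>, where the event \<open>\<tau> > t\<close> only involves the first
  \<open>t + 1\<close> positions and can therefore be computed in the finite Ionescu-Tulcea product.
\<close>

lemma expected_hitting_time_eq_suminf_survival:
  "expected_hitting_time S P v u = (\<Sum>t. ennreal (survival (S - {v}) P t u))"
proof -
  let ?N = "PiM UNIV (\<lambda>_. count_space (UNIV :: 's set))"
  let ?A = "\<lambda>t. {\<omega>. \<forall>m\<le>t. \<omega> m \<noteq> v}"
  have sets: "sets (walk_measure S P u) = sets ?N"
    unfolding walk_measure_def by (rule IT.PF.sets_lim)
  have A: "?A t \<in> sets (walk_measure S P u)" for t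
  proof -
    have "?A t = {\<omega> \<in> space ?N. \<forall>m\<le>t. \<omega> m \<noteq> v}" by (simp add: space_PiM)
    then show ?thesis
      unfolding sets by (simp only: sets_avoiding[OF subset_UNIV])
  qed
  have "expected_hitting_time S P v u = (\<Sum>t. emeasure (walk_measure S P u) (?A t))"
  proof -
    have "(\<integral>\<^sup>+ \<omega>. (\<Sum>t. indicator (?A t) \<omega>) \<partial>walk_measure S P u) =
        (\<Sum>t. \<integral>\<^sup>+ \<omega>. indicator (?A t) \<omega> \<partial>walk_measure S P u)"
      by (rule nn_integral_suminf) (rule borel_measurable_indicator, rule A)
    then show ?thesis
      unfolding expected_hitting_time_def first_visit_suminf nn_integral_indicator[OF A] .
  qed
  also have "\<dots> = (\<Sum>t. ennreal (survival (S - {v}) P t u))"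
  proof (intro suminf_cong)
    fix t
    let ?M = "PiM {0..<Suc t} (\<lambda>_. count_space (UNIV :: 's set))"
    let ?B = "{\<omega> \<in> space ?M. \<forall>m\<le>t. \<omega> m \<noteq> v}"
    have B: "?B \<in> sets ?M"
      by (rule sets_avoiding) auto
    have C: "sets (IT.C 0 (Suc t) (\<lambda>_. undefined)) = sets ?M"
      using IT.sets_C[of "\<lambda>_. undefined" 0 "Suc t"] by (simp add: space_PiM del: IT.C.simps)
    have emb: "prod_emb UNIV (\<lambda>_. count_space UNIV) {0..<Suc t} ?B = ?A t"
      by (auto simp: prod_emb_def space_PiM)
    have "emeasure (walk_measure S P u) (?A t) = emeasure (IT.CI {0..<Suc t}) ?B"
      unfolding walk_measure_def emb[symmetric] by (rule IT.lim[OF finite_atLeastLessThan B])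
    also have "\<dots> = emeasure (IT.C 0 (Suc t) (\<lambda>_. undefined)) ?B"
      unfolding IT.emeasure_CI[OF subset_refl B]
      using sets.sets_into_space[OF B] by (subst prod_emb_id) (auto simp: space_PiM)
    also have "\<dots> = (\<integral>\<^sup>+ \<omega>. indicator ?B \<omega> \<partial>IT.C 0 (Suc t) (\<lambda>_. undefined))"
      using B unfolding C[symmetric] by (rule nn_integral_indicator[symmetric])
    also have "\<dots> = (\<integral>\<^sup>+ \<omega>. indicator (?A t) \<omega> * 1 \<partial>IT.C 0 (Suc t) (\<lambda>_. undefined))"
    proof (rule nn_integral_cong)
      fix \<omega> assume "\<omega> \<in> space (IT.C 0 (Suc t) (\<lambda>_. undefined))"
      then have "\<omega> \<in> space ?M"
        unfolding sets_eq_imp_space_eq[OF C] .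
      then show "(indicator ?B \<omega> :: ennreal) = indicator (?A t) \<omega> * 1"
        unfolding indicator_def by simp
    qed
    also have "\<dots> = ennreal (survival (S - {v}) P t u)"
      using nn_integral_C_avoiding[where s = 0 and g = "\<lambda>_. 1" and t = t] by simp
    finally show "emeasure (walk_measure S P u) (?A t) = ennreal (survival (S - {v}) P t u)" .
  qed
  finally show ?thesis .
qed

end

section \<open>Perron eigenvectors\<close>

text \<open>
  Measured in the norm \<open>Max (\<bar>x i\<bar> / \<nu> i)\<close>, a nonnegative matrix with positive eigenvector
  \<open>\<nu>\<close> has operator norm at most \<open>\<theta>\<close>.
\<close>

lemma eigenvalue_le_positive_eigenvalue:
  assumes fin: "finite S"
    and nonneg: "\<And>i j. i \<in> S \<Longrightarrow> j \<in> S \<Longrightarrow> 0 \<le> M i j"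
    and pos: "\<And>i. i \<in> S \<Longrightarrow> 0 < \<nu> i"
    and eig: "\<And>i. i \<in> S \<Longrightarrow> (\<Sum>j\<in>S. M i j * \<nu> j) = \<theta> * \<nu> i"
    and ev: "eigenvalue_smat S M \<mu>"
  shows "\<mu> \<le> \<theta>"
proof -
  obtain x i0 where i0: "i0 \<in> S" "x i0 \<noteq> 0"
    and x: "\<And>i. i \<in> S \<Longrightarrow> (\<Sum>j\<in>S. M i j * x j) = \<mu> * x i"
    using ev unfolding eigenvalue_smat_def by blast
  define r where "r = Max ((\<lambda>i. \<bar>x i\<bar> / \<nu> i) ` S)"
  have r_ge: "\<bar>x j\<bar> / \<nu> j \<le> r" if "j \<in> S" for j
    unfolding r_def using fin that by (intro Max_ge) auto
  have "r \<in> (\<lambda>i. \<bar>x i\<bar> / \<nu> i) ` S"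
    unfolding r_def using fin i0 by (intro Max_in) auto
  then obtain i where i: "i \<in> S" "r = \<bar>x i\<bar> / \<nu> i" by blast
  have r_pos: "0 < r"
    using r_ge[OF i0(1)] i0 pos[OF i0(1)] by (meson divide_pos_pos less_le_trans zero_less_abs_iff)
  have xi: "\<bar>x i\<bar> = r * \<nu> i"
    using i pos[OF i(1)] by simp
  have le: "\<bar>x j\<bar> \<le> r * \<nu> j" if "j \<in> S" for j
    using r_ge[OF that] pos[OF that] by (simp add: pos_divide_le_eq)
  have "\<mu> * \<bar>x i\<bar> \<le> \<bar>\<mu> * x i\<bar>"
    by (simp add: abs_mult mult_right_mono)
  also have "\<dots> = \<bar>\<Sum>j\<in>S. M i j * x j\<bar>"
    using x i by simp
  also have "\<dots> \<le> (\<Sum>j\<in>S. \<bar>M i j * x j\<bar>)"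
    by (rule sum_abs)
  also have "\<dots> \<le> (\<Sum>j\<in>S. M i j * (r * \<nu> j))"
  proof (rule sum_mono)
    fix j assume j: "j \<in> S"
    show "\<bar>M i j * x j\<bar> \<le> M i j * (r * \<nu> j)"
      unfolding abs_mult abs_of_nonneg[OF nonneg[OF i(1) j]]
      by (rule mult_left_mono[OF le[OF j] nonneg[OF i(1) j]])
  qed
  also have "\<dots> = r * (\<Sum>j\<in>S. M i j * \<nu> j)"
    by (simp add: sum_distrib_left algebra_simps)
  also have "\<dots> = \<theta> * \<bar>x i\<bar>"
    using eig i xi by simp
  finally have "\<mu> * (r * \<nu> i) \<le> \<theta> * (r * \<nu> i)"
    unfolding xi .
  then show ?thesis
    using r_pos pos[OF i(1)] by simp
qed

text \<open>
  For connected \<open>K\<close>, stated here as the absence of nonempty proper sets closed under adjacency, a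
  positive unit eigenvector is the Perron eigenvector.  Maximality of its eigenvalue is the
  preceding lemma.  For uniqueness let \<open>y\<close> be another candidate and \<open>r\<close> the largest ratio
  \<open>y i / \<nu> i\<close>; then \<open>r \<nu> - y\<close> is nonnegative and solves the same eigenvalue equation, so its zero set,
  which is not empty, is closed under adjacency.
\<close>

lemma perron_vector_eqI:
  assumes fin: "finite (pverts K)" and ne: "pverts K \<noteq> {}"
    and irred: "\<And>Z. Z \<subseteq> pverts K \<Longrightarrow> Z \<noteq> {} \<Longrightarrow>
      (\<And>i j. i \<in> Z \<Longrightarrow> j \<in> pverts K \<Longrightarrow> (i, j) \<in> parcs K \<Longrightarrow> j \<in> Z) \<Longrightarrow> Z = pverts K"
    and pos: "\<And>i. i \<in> pverts K \<Longrightarrow> 0 < \<nu> i"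
    and zero: "\<And>i. i \<notin> pverts K \<Longrightarrow> \<nu> i = 0"
    and unit: "(\<Sum>v\<in>pverts K. (\<nu> v)\<^sup>2) = 1"
    and eig: "\<And>i. i \<in> pverts K \<Longrightarrow> (\<Sum>j\<in>pverts K. adj_smat K i j * \<nu> j) = \<theta> * \<nu> i"
  shows "perron_vector K = \<nu>"
proof -
  let ?S = "pverts K" and ?A = "adj_smat K"
  have A0: "0 \<le> ?A i j" for i j
    by (simp add: adj_smat_def)
  have ev: "eigenvalue_smat ?S ?A \<theta>"
    unfolding eigenvalue_smat_def using ne pos eig by (intro exI[of _ \<nu>]) force
  have top: "\<mu> \<le> \<theta>" if "eigenvalue_smat ?S ?A \<mu>" for \<mu>
    using eigenvalue_le_positive_eigenvalue[OF fin A0 pos eig that] .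
  show ?thesis
    unfolding perron_vector_def
  proof (rule the_equality)
    show "is_perron_vector K \<nu> \<and> (\<forall>v. v \<notin> ?S \<longrightarrow> \<nu> v = 0)"
      unfolding is_perron_vector_def using pos zero unit eig ev top by blast
  next
    fix y assume y: "is_perron_vector K y \<and> (\<forall>v. v \<notin> ?S \<longrightarrow> y v = 0)"
    then obtain \<theta>' where ypos: "\<And>i. i \<in> ?S \<Longrightarrow> 0 < y i" and yunit: "(\<Sum>v\<in>?S. (y v)\<^sup>2) = 1"
      and ev': "eigenvalue_smat ?S ?A \<theta>'" and top': "\<And>\<mu>. eigenvalue_smat ?S ?A \<mu> \<Longrightarrow> \<mu> \<le> \<theta>'"
      and yeig': "\<And>i. i \<in> ?S \<Longrightarrow> (\<Sum>j\<in>?S. ?A i j * y j) = \<theta>' * y i"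
      unfolding is_perron_vector_def by blast
    have "\<theta>' = \<theta>"
      using top[OF ev'] top'[OF ev] by simp
    then have yeig: "(\<Sum>j\<in>?S. ?A i j * y j) = \<theta> * y i" if "i \<in> ?S" for i
      using yeig'[OF that] by simp
    define r where "r = Max ((\<lambda>i. y i / \<nu> i) ` ?S)"
    have le: "y j \<le> r * \<nu> j" if "j \<in> ?S" for j
    proof -
      have "y j / \<nu> j \<le> r"
        unfolding r_def using fin that by (intro Max_ge) auto
      then show ?thesis
        using pos[OF that] by (simp add: pos_divide_le_eq)
    qed
    have "r \<in> (\<lambda>i. y i / \<nu> i) ` ?S"
      unfolding r_def using fin ne by (intro Max_in) auto
    then obtain i0 where i0: "i0 \<in> ?S" "r = y i0 / \<nu> i0" by blast
    have r_pos: "0 < r"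
      unfolding i0(2) using ypos pos i0(1) by (intro divide_pos_pos) auto
    define Z where "Z = {i \<in> ?S. y i = r * \<nu> i}"
    have "i0 \<in> Z"
      unfolding Z_def using i0 pos[OF i0(1)] by simp
    have "Z = ?S"
    proof (rule irred)
      show "Z \<subseteq> ?S" unfolding Z_def by auto
      show "Z \<noteq> {}" using \<open>i0 \<in> Z\<close> by auto
      fix i j assume i: "i \<in> Z" and j: "j \<in> ?S" and ij: "(i, j) \<in> parcs K"
      have iS: "i \<in> ?S" and yi: "y i = r * \<nu> i"
        using i unfolding Z_def by auto
      have "(\<Sum>j\<in>?S. ?A i j * (r * \<nu> j - y j)) =
          r * (\<Sum>j\<in>?S. ?A i j * \<nu> j) - (\<Sum>j\<in>?S. ?A i j * y j)"
        by (simp add: sum_distrib_left sum_subtractf algebra_simps)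
      also have "\<dots> = 0"
        using eig[OF iS] yeig[OF iS] yi by simp
      finally have "?A i j * (r * \<nu> j - y j) = 0"
        using fin j le A0 by (subst (asm) sum_nonneg_eq_0_iff) auto
      then show "j \<in> Z"
        using ij j by (simp add: Z_def adj_smat_def)
    qed
    then have yr: "y i = r * \<nu> i" if "i \<in> ?S" for i
      using that unfolding Z_def by blast
    have "1 = r\<^sup>2 * (\<Sum>v\<in>?S. (\<nu> v)\<^sup>2)"
      using yunit yr by (simp add: power_mult_distrib sum_distrib_left)
    then have "r = 1"
      using unit r_pos by (simp add: power2_eq_1_iff)
    then show "y = \<nu>"
      using yr y zero by (intro ext) (metis mult_1)
  qed
qed

section \<open>Random walks on the cone over a regular graph\<close>

text \<open>
  The common form of the simple and the maximal entropy random walk on the cone: from the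
  apex the walk moves to a uniform vertex of \<open>G\<close>; from a vertex of \<open>G\<close> it moves to the apex
  with probability \<open>p\<close> and to each neighbour in \<open>G\<close> with probability \<open>q\<close>.
\<close>

definition cone_step :: "'a pair_pre_digraph \<Rightarrow> 'a \<Rightarrow> real \<Rightarrow> real \<Rightarrow> 'a smat" where
  "cone_step G a q p i j =
     (if j = a then if i = a then 0 else 1 / real (card (pverts G))
      else if i = a then p else q * adj_smat G i j)"

text \<open>
  The same walk observed only through the blocks of an equitable partition.
\<close>

definition cone_quotient_step :: "'x \<Rightarrow> ('x \<Rightarrow> nat) \<Rightarrow> 'x smat \<Rightarrow> nat \<Rightarrow> real \<Rightarrow> real \<Rightarrow> 'x smat" where
  "cone_quotient_step a1 kx B n q p i j =
     (if j = a1 then if i = a1 then 0 else real (kx i) / real n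
      else if i = a1 then p else q * B i j)"

locale regular_cone =
  fixes G :: "'a pair_pre_digraph" and k :: nat and a :: 'a
  assumes graph: "pair_graph G" and nonempty: "pverts G \<noteq> {}"
    and regular: "\<forall>v\<in>pverts G. out_degree (with_proj G) v = k"
    and apex: "a \<notin> pverts G"
begin

abbreviation "V \<equiv> pverts G"
abbreviation "n \<equiv> card V"
abbreviation "K \<equiv> cone_graph G a"

lemma finite_V: "finite V"
  using graph by (simp add: pair_fin_digraph.pair_finite_verts pair_digraph.axioms(1) pair_graph.axioms(1))

lemma n_pos: "0 < n"
  using finite_V nonempty by (simp add: card_gt_0_iff)

lemma arcs_in_V: "(u, w) \<in> parcs G \<Longrightarrow> u \<in> V \<and> w \<in> V"
proof -
  interpret pair_graph G by (rule graph)
  show "(u, w) \<in> parcs G \<Longrightarrow> u \<in> V \<and> w \<in> V" using wellformed' by blast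
qed

lemma arcs_sym: "(u, w) \<in> parcs G \<longleftrightarrow> (w, u) \<in> parcs G"
proof -
  interpret pair_graph G by (rule graph)
  show ?thesis using arcs_symmetric by blast
qed

lemma adj_sym: "adj_smat G u w = adj_smat G w u"
  using arcs_sym by (simp add: adj_smat_def)

lemma card_nbrs: "w \<in> V \<Longrightarrow> card (nbrs G w) = k"
proof -
  assume w: "w \<in> V"
  have "out_arcs (with_proj G) w = Pair w ` nbrs G w"
    using arcs_sym by (auto simp: out_arcs_def nbrs_def)
  then have "card (out_arcs (with_proj G) w) = card (nbrs G w)"
    by (simp add: card_image inj_on_def)
  then show ?thesis
    using regular w by (simp add: out_degree_def)
qed

lemma sum_adj: "finite C \<Longrightarrow> (\<Sum>u\<in>C. adj_smat G u w) = real (card (nbrs G w \<inter> C))"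
  by (simp add: adj_smat_def nbrs_def sum.If_cases Int_commute Collect_conj_eq[symmetric] Int_def
      conj_commute)

lemma sum_adj_V: "w \<in> V \<Longrightarrow> (\<Sum>u\<in>V. adj_smat G u w) = real k"
proof -
  assume w: "w \<in> V"
  have "nbrs G w \<inter> V = nbrs G w"
    using arcs_in_V by (auto simp: nbrs_def)
  then show ?thesis
    using sum_adj[OF finite_V] card_nbrs[OF w] by simp
qed

lemma adj_nonneg: "0 \<le> adj_smat G u w"
  by (simp add: adj_smat_def)

lemma pverts_K: "pverts K = insert a V"
  by (simp add: cone_graph_def)

lemma adj_K: "i \<in> insert a V \<Longrightarrow> j \<in> insert a V \<Longrightarrow>
    adj_smat K i j = (if i = a then if j = a then 0 else 1 else if j = a then 1 else adj_smat G i j)"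
  using apex arcs_in_V by (auto simp: adj_smat_def cone_graph_def)

lemma sum_K: "(\<Sum>i\<in>insert a V. g i) = g a + (\<Sum>i\<in>V. g i :: real)"
  using finite_V apex by simp

lemma cone_irreducible:
  assumes "Z \<subseteq> pverts K" "Z \<noteq> {}"
    and closed: "\<And>i j. i \<in> Z \<Longrightarrow> j \<in> pverts K \<Longrightarrow> (i, j) \<in> parcs K \<Longrightarrow> j \<in> Z"
  shows "Z = pverts K"
proof -
  obtain i where i: "i \<in> Z" using assms(2) by blast
  have "a \<in> Z"
  proof (cases "i = a")
    case False
    then show ?thesis
      using assms(1) i by (intro closed[OF i]) (auto simp: cone_graph_def)
  qed (use i in simp)
  then have "j \<in> Z" if "j \<in> V" for j
    using that by (intro closed[OF \<open>a \<in> Z\<close>]) (auto simp: cone_graph_def)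
  then show ?thesis
    using assms(1) \<open>a \<in> Z\<close> by (auto simp: pverts_K)
qed

text \<open>
  The vector that is \<open>1\<close> on \<open>G\<close> and \<open>l - k\<close> at the apex is an eigenvector: at a vertex of
  \<open>G\<close> the neighbours contribute \<open>k + (l - k) = l\<close>, and at the apex they contribute
  \<open>n = l * (l - k)\<close>.
\<close>

lemma perron_vector_cone:
  fixes l :: real
  assumes l: "l > real k" "l * (l - real k) = real n"
  obtains c where "c > 0" "\<And>v. v \<in> V \<Longrightarrow> perron_vector K v = c"
    "perron_vector K a = c * (l - real k)"
proof -
  define \<nu>0 where "\<nu>0 i = (if i = a then l - real k else if i \<in> V then 1 else 0)" for i
  define s where "s = (\<Sum>v\<in>pverts K. (\<nu>0 v)\<^sup>2)"
  have "0 < s"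
    unfolding s_def pverts_K using finite_V l
    by (intro sum_pos) (auto simp: \<nu>0_def)
  define c where "c = 1 / sqrt s"
  have c: "0 < c" "c\<^sup>2 * s = 1"
    unfolding c_def using \<open>0 < s\<close> by (simp_all add: power_divide)
  have "perron_vector K = (\<lambda>i. c * \<nu>0 i)"
  proof (rule perron_vector_eqI[where \<theta> = l])
    show "finite (pverts K)" "pverts K \<noteq> {}"
      using finite_V by (simp_all add: pverts_K)
    show "0 < c * \<nu>0 i" if "i \<in> pverts K" for i
      using that c l by (auto simp: pverts_K \<nu>0_def)
    show "c * \<nu>0 i = 0" if "i \<notin> pverts K" for i
      using that by (simp add: pverts_K \<nu>0_def)
    show "(\<Sum>v\<in>pverts K. (c * \<nu>0 v)\<^sup>2) = 1"
      using c by (simp add: power_mult_distrib sum_distrib_left[symmetric] s_def)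
    show "(\<Sum>j\<in>pverts K. adj_smat K i j * (c * \<nu>0 j)) = l * (c * \<nu>0 i)" if i: "i \<in> pverts K" for i
    proof (cases "i = a")
      case True
      have "(\<Sum>j\<in>V. adj_smat K i j * (c * \<nu>0 j)) = (\<Sum>j\<in>V. c)"
        using apex True by (intro sum.cong) (auto simp: adj_K \<nu>0_def)
      then show ?thesis
        using True l by (simp add: pverts_K sum_K adj_K \<nu>0_def algebra_simps)
    next
      case False
      then have "i \<in> V" using i by (simp add: pverts_K)
      have "(\<Sum>j\<in>V. adj_smat K i j * (c * \<nu>0 j)) = (\<Sum>j\<in>V. adj_smat G j i) * c"
        unfolding sum_distrib_right
        using apex \<open>i \<in> V\<close> by (intro sum.cong) (auto simp: adj_K \<nu>0_def adj_sym[of i])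
      then show ?thesis
        using False \<open>i \<in> V\<close> sum_adj_V[OF \<open>i \<in> V\<close>]
        by (simp add: pverts_K sum_K adj_K \<nu>0_def algebra_simps)
    qed
  qed (use cone_irreducible in blast)
  then show thesis
    using c(1) apex by (intro that[of c]) (auto simp: \<nu>0_def)
qed

lemma cone_step_stochastic:
  assumes "q * real k + p = 1" "j \<in> insert a V"
  shows "(\<Sum>i\<in>insert a V. cone_step G a q p i j) = 1"
proof (cases "j = a")
  case True
  have "(\<Sum>i\<in>V. cone_step G a q p i j) = (\<Sum>i\<in>V. 1 / real n)"
    using True apex by (intro sum.cong) (auto simp: cone_step_def)
  then show ?thesis
    using True n_pos by (simp add: sum_K cone_step_def)
next
  case False
  then have "(\<Sum>i\<in>V. cone_step G a q p i j) = (\<Sum>i\<in>V. q * adj_smat G i j)"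
    using apex by (intro sum.cong) (auto simp: cone_step_def)
  also have "\<dots> = q * real k"
    using sum_adj_V[of j] False assms(2) by (simp add: sum_distrib_left[symmetric])
  finally show ?thesis
    using assms False by (simp add: sum_K cone_step_def)
qed

lemma cone_step_nonneg: "0 \<le> q \<Longrightarrow> 0 \<le> p \<Longrightarrow> 0 \<le> cone_step G a q p i j"
  by (simp add: cone_step_def adj_smat_def)

text \<open>
  Every vertex of \<open>G\<close> moves to the apex with the same probability \<open>p\<close>, so the hitting time
  of the apex is geometric.
\<close>

lemma expected_hitting_time_apex:
  assumes qp: "0 \<le> q" "0 < p" "q * real k + p = 1"
    and P: "\<And>i j. i \<in> insert a V \<Longrightarrow> j \<in> insert a V \<Longrightarrow> P i j = cone_step G a q p i j"
    and u: "u \<in> V"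
  shows "expected_hitting_time (insert a V) P a u = ennreal (1 / p)"
proof -
  have "insert a V - {a} = V" using apex by auto
  have surv: "survival V P t w = (1 - p) ^ t" if "w \<in> V" for t w
    using that
  proof (induction t arbitrary: w)
    case (Suc t)
    have "survival V P (Suc t) w = (\<Sum>i\<in>V. (1 - p) ^ t * (q * adj_smat G i w))"
      using Suc P apex by (auto intro!: sum.cong simp: cone_step_def)
    also have "\<dots> = (1 - p) ^ t * (q * real k)"
      using sum_adj_V[OF Suc.prems] by (simp add: sum_distrib_left[symmetric])
    also have "q * real k = 1 - p" using qp by simp
    finally show ?case by simp
  qed simp
  have "p \<le> 1" using qp mult_nonneg_nonneg[of q "real k"] by linarith
  have "expected_hitting_time (insert a V) P a u = (\<Sum>t. ennreal (survival (insert a V - {a}) P t u))"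
    using finite_V u apex P cone_step_nonneg[of q p] cone_step_stochastic[OF qp(3)] qp
    by (intro expected_hitting_time_eq_suminf_survival) auto
  also have "\<dots> = (\<Sum>t. ennreal ((1 - p) ^ t))"
    using surv[OF u] \<open>insert a V - {a} = V\<close> by simp
  also have "\<dots> = ennreal (1 / p)"
    using geometric_sums[of "1 - p"] qp \<open>p \<le> 1\<close>
    by (subst suminf_ennreal_eq[where x = "1 / p"]) auto
  finally show ?thesis .
qed

end

section \<open>The cone over an equitable graph\<close>

locale equitable_cone = regular_cone G k a
  for G :: "'a pair_pre_digraph" and k a +
  fixes f :: "'a \<Rightarrow> 'a \<Rightarrow> 'x" and X :: "'x set" and x0 a0 a1 :: 'x and B :: "'x smat"
  assumes connected: "Digraph_Component.connected (with_proj G)"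
    and equitable: "f_equitable G f X x0 B"
    and a1_notin: "a1 \<notin> X"
begin

abbreviation "F \<equiv> fibre V f"
abbreviation "kx \<equiv> fibre_size V f"
abbreviation "fp \<equiv> cone_fun a a0 a1 f"

lemma finite_X: "finite X" and x0_in: "x0 \<in> X"
  and f_in: "v \<in> V \<Longrightarrow> u \<in> V \<Longrightarrow> f v u \<in> X"
  and fibre_x0: "v \<in> V \<Longrightarrow> F x0 v = {v}"
  using equitable by (auto simp: f_equitable_def)

lemma f_eq_x0_iff: "v \<in> V \<Longrightarrow> u \<in> V \<Longrightarrow> f v u = x0 \<longleftrightarrow> u = v"
  using fibre_x0[of v] by (auto simp: fibre_def)

lemma finite_fibre: "finite (F x v)"
  using finite_V by (simp add: fibre_def)

lemma card_nbrs_fibre: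
  assumes "v \<in> V" "u \<in> V" "x \<in> X"
  shows "real (card (nbrs G u \<inter> F x v)) = B x (f v u)"
proof -
  have "is_quotient_matrix G X (\<lambda>x. F x v) B"
    using equitable assms(1) by (simp add: f_equitable_def)
  moreover have "u \<in> F (f v u) v"
    using assms by (simp add: fibre_def)
  ultimately show ?thesis
    using f_in[of v u] assms unfolding is_quotient_matrix_def by blast
qed

lemma fibre_nonempty:
  assumes "v \<in> V" "x \<in> X"
  obtains u where "u \<in> V" "f v u = x"
proof -
  have "partition_on V ((\<lambda>x. F x v) ` X)"
    using equitable assms(1) by (simp add: f_equitable_def equitable_partition_def)
  then have "F x v \<noteq> {}"
    using assms(2) by (auto simp: partition_on_def)
  then show thesis
    using that by (auto simp: fibre_def)
qed

lemma B_nonneg: "x \<in> X \<Longrightarrow> y \<in> X \<Longrightarrow> 0 \<le> B x y"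
proof -
  assume x: "x \<in> X" and y: "y \<in> X"
  obtain v where v: "v \<in> V" using nonempty by blast
  obtain u where u: "u \<in> V" "f v u = y" using fibre_nonempty[OF v y] .
  show "0 \<le> B x y"
    using card_nbrs_fibre[OF v u(1) x] u(2) of_nat_0_le_iff by metis
qed

lemma B_col_sum: "y \<in> X \<Longrightarrow> (\<Sum>x\<in>X. B x y) = real k"
proof -
  assume y: "y \<in> X"
  obtain v where v: "v \<in> V" using nonempty by blast
  obtain u where u: "u \<in> V" "f v u = y" using fibre_nonempty[OF v y] .
  have "(\<Sum>x\<in>X. B x y) = (\<Sum>x\<in>X. \<Sum>w | w \<in> V \<and> f v w = x. adj_smat G w u)"
    using card_nbrs_fibre[OF v u(1)] u(2) sum_adj[OF finite_fibre]
    by (intro sum.cong refl) (simp add: fibre_def)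
  also have "\<dots> = (\<Sum>w\<in>V. adj_smat G w u)"
    using finite_V finite_X f_in[OF v] by (intro sum.group) auto
  also have "\<dots> = real k"
    using sum_adj_V[OF u(1)] .
  finally show ?thesis .
qed

text \<open>
  Both sides count the edges between two blocks.
\<close>

lemma edge_count_between_fibres:
  assumes v: "v \<in> V" and xy: "x \<in> X" "y \<in> X"
  shows "real (card (F y v)) * B x y = real (card (F x v)) * B y x"
proof -
  have count: "(\<Sum>w\<in>F y v. \<Sum>u\<in>F x v. adj_smat G u w) = real (card (F y v)) * B x y"
    if "x \<in> X" for x y
  proof -
    have "(\<Sum>u\<in>F x v. adj_smat G u w) = B x y" if "w \<in> F y v" for w
      using that sum_adj[OF finite_fibre] card_nbrs_fibre[OF v _ \<open>x \<in> X\<close>, of w] by (simp add: fibre_def)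
    then show ?thesis by simp
  qed
  have "(\<Sum>w\<in>F y v. \<Sum>u\<in>F x v. adj_smat G u w) = (\<Sum>u\<in>F x v. \<Sum>w\<in>F y v. adj_smat G w u)"
    by (subst sum.swap) (simp add: adj_sym)
  then show ?thesis
    using count[OF xy(1), of y] count[OF xy(2), of x] by simp
qed

text \<open>
  Edge counting determines the size of a block from that of an adjacent block through
  entries of \<open>B\<close>, which do not depend on the base vertex.  The block of the base vertex has size
  one, and a path from there reaches every block.
\<close>

lemma card_fibre_indep:
  assumes v: "v \<in> V" and v': "v' \<in> V" and x: "x \<in> X"
  shows "card (F x v) = card (F x v')"
proof -
  obtain u where u: "u \<in> V" "f v u = x" using fibre_nonempty[OF v x] .
  interpret pair_graph G by (rule graph)
  have "v \<rightarrow>\<^sup>*\<^bsub>with_proj (mk_symmetric (with_proj G))\<^esub> u"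
    using connected v u by (simp add: Digraph_Component.connected_def strongly_connected_def)
  then have "v \<rightarrow>\<^sup>*\<^bsub>with_proj G\<^esub> u"
    using reachable_mk_symmetric_eq[OF sym_arcs] by simp
  then have "u \<in> V \<and> card (F (f v u) v) = card (F (f v u) v')"
  proof (induction rule: reachable_induct)
    case base
    then show ?case
      using v v' f_eq_x0_iff[OF v v] fibre_x0 by simp
  next
    case (step u w)
    then have arc: "(u, w) \<in> parcs G" and u: "u \<in> V" and w: "w \<in> V"
      using arcs_in_V by auto
    let ?x = "f v u" and ?y = "f v w"
    have xy: "?x \<in> X" "?y \<in> X" using f_in v u w by auto
    have "w \<in> nbrs G u \<inter> F ?y v"
      using arc arcs_sym w by (auto simp: nbrs_def fibre_def)
    then have "0 < card (nbrs G u \<inter> F ?y v)"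
      using finite_fibre by (auto simp: card_gt_0_iff)
    then have yx: "0 < B ?y ?x"
      using card_nbrs_fibre[OF v u xy(2)] by (metis of_nat_0_less_iff)
    have "0 < card (F ?x v)"
      using u finite_fibre by (auto simp: card_gt_0_iff fibre_def)
    then have "0 < real (card (F ?y v)) * B ?x ?y"
      using edge_count_between_fibres[OF v xy] yx by simp
    then have "B ?x ?y \<noteq> 0" by auto
    moreover have "real (card (F ?y v)) * B ?x ?y = real (card (F ?y v')) * B ?x ?y"
      using edge_count_between_fibres[OF v xy] edge_count_between_fibres[OF v' xy] step.IH by simp
    ultimately show ?case
      using w by simp
  qed
  then show ?thesis using u(2) by simp
qed

lemma card_fibre: "v \<in> V \<Longrightarrow> x \<in> X \<Longrightarrow> card (F x v) = kx x"
proof -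
  assume v: "v \<in> V" and x: "x \<in> X"
  have "kx x = card (F x v)"
    unfolding fibre_size_def
  proof (rule the_equality)
    show "\<forall>w\<in>V. card (F x w) = card (F x v)"
      using card_fibre_indep v x by blast
  qed (use v in simp)
  then show ?thesis by simp
qed

lemma sum_fibre_size: "(\<Sum>x\<in>X. real (kx x)) = real n"
proof -
  obtain v where v: "v \<in> V" using nonempty by blast
  have "(\<Sum>x\<in>X. real (kx x)) = (\<Sum>x\<in>X. \<Sum>w | w \<in> V \<and> f v w = x. 1)"
    using card_fibre[OF v] by (intro sum.cong refl) (simp add: fibre_def)
  also have "\<dots> = (\<Sum>w\<in>V. 1)"
    using finite_V finite_X f_in[OF v] by (intro sum.group) auto
  finally show ?thesis by simp
qed

abbreviation "I0 \<equiv> insert a1 X - {x0}"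

text \<open>
  The blocks around \<open>v\<close>, together with the apex, lump the walk killed at \<open>v\<close>.  From the
  apex the block with index \<open>i\<close> receives its share \<open>k\<^sub>i / n\<close> of the vertices, from a vertex of
  \<open>G\<close> it receives \<open>q\<close> times the number of neighbours in that block.
\<close>

lemma cone_step_lumps:
  assumes v: "v \<in> V" and i: "i \<in> I0" and u: "u \<in> insert a V - {v}"
  shows "(\<Sum>w | w \<in> insert a V - {v} \<and> fp v w = i. cone_step G a q p w u) =
    cone_quotient_step a1 kx B n q p i (fp v u)"
proof -
  have va: "v \<noteq> a" using v apex by auto
  have fp_V: "fp v w = f v w" if "w \<in> V" for w
    using that va apex by (auto simp: cone_fun_def)
  have fp_a: "fp v a = a1"
    using va by (simp add: cone_fun_def)
  have ne: "f v w \<noteq> a1" if "w \<in> V" for w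
    using f_in[OF v that] a1_notin by auto
  show ?thesis
  proof (cases "i = a1")
    case True
    have "{w. w \<in> insert a V - {v} \<and> fp v w = i} = {a}"
      using True fp_a fp_V ne va by auto
    then show ?thesis
      using True u fp_a fp_V ne by (auto simp: cone_step_def cone_quotient_step_def)
  next
    case False
    then have iX: "i \<in> X" "i \<noteq> x0" using i by auto
    have "{w. w \<in> insert a V - {v} \<and> fp v w = i} = F i v"
      using False iX fp_a fp_V f_eq_x0_iff[OF v v] v by (auto simp: fibre_def)
    moreover have "(\<Sum>w\<in>F i v. cone_step G a q p w u) =
        cone_quotient_step a1 kx B n q p i (fp v u)"
    proof (cases "u = a")
      case True
      have "(\<Sum>w\<in>F i v. cone_step G a q p w u) = (\<Sum>w\<in>F i v. 1 / real n)"
        using True apex by (intro sum.cong) (auto simp: cone_step_def fibre_def)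
      then show ?thesis
        using True False card_fibre[OF v iX(1)] fp_a by (simp add: cone_quotient_step_def)
    next
      case u_ne: False
      then have uV: "u \<in> V" using u by simp
      have "(\<Sum>w\<in>F i v. cone_step G a q p w u) = q * (\<Sum>w\<in>F i v. adj_smat G w u)"
        unfolding sum_distrib_left
        using u_ne apex by (intro sum.cong) (auto simp: cone_step_def fibre_def)
      also have "\<dots> = q * B i (f v u)"
        using sum_adj[OF finite_fibre] card_nbrs_fibre[OF v uV iX(1)] by simp
      finally show ?thesis
        using False ne[OF uV] fp_V[OF uV] by (simp add: cone_quotient_step_def)
    qed
    ultimately show ?thesis by simp
  qed
qed

text \<open>
  One step leads from any vertex of \<open>G\<close> to the apex with probability \<open>p\<close>, and from the
  apex to \<open>v\<close> with probability \<open>1 / n\<close>.  This yields a superharmonic bound with one value \<open>\<alpha>\<close> on \<open>G\<close> and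
  one value \<open>\<beta>\<close> at the apex, subject to \<open>\<alpha> p \<ge> 1 + \<beta> p\<close> and \<open>\<beta> \<ge> 1 + \<alpha> (n - 1) / n\<close>.
\<close>

lemma survival_cone_step_summable:
  assumes qp: "0 \<le> q" "0 < p" "q * real k + p = 1"
    and v: "v \<in> V" and u: "u \<in> insert a V - {v}"
  shows "summable (\<lambda>t. survival (insert a V - {v}) (cone_step G a q p) t u)"
proof -
  \<comment> \<open>The first condition holds with equality, the second with slack \<open>1 / (p n)\<close>.\<close>
  define \<beta> where "\<beta> = real n + real n / p"
  define \<alpha> where "\<alpha> = 1 / p + \<beta>"
  have pos: "0 \<le> \<beta>" "0 \<le> \<alpha>" unfolding \<beta>_def \<alpha>_def using qp by simp_all
  have va: "v \<noteq> a" using v apex by auto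
  have J: "insert a V - {v} = insert a (V - {v})" using va by auto
  define g where "g i = (if i = a then \<beta> else \<alpha>)" for i
  show ?thesis
  proof (rule survival_summable[where g = g])
    show "1 + (\<Sum>i\<in>insert a V - {v}. g i * cone_step G a q p i w) \<le> g w"
      if w: "w \<in> insert a V - {v}" for w
    proof -
      have split: "(\<Sum>i\<in>insert a V - {v}. g i * cone_step G a q p i w) =
          \<beta> * cone_step G a q p a w + (\<Sum>i\<in>V - {v}. g i * cone_step G a q p i w)"
        unfolding J using finite_V apex by (subst sum.insert) (auto simp: g_def)
      show ?thesis
      proof (cases "w = a")
        case True
        have "(\<Sum>i\<in>V - {v}. g i * cone_step G a q p i w) = (\<Sum>i\<in>V - {v}. \<alpha> / real n)"
          using True apex by (intro sum.cong) (auto simp: g_def cone_step_def)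
        also have "\<dots> = \<alpha> * (real n - 1) / real n"
          using finite_V v n_pos by (simp add: card_Diff_singleton of_nat_diff)
        also have "\<dots> = \<alpha> - \<alpha> / real n"
          using n_pos by (simp add: field_simps)
        finally have "1 + (\<Sum>i\<in>insert a V - {v}. g i * cone_step G a q p i w) = 1 + \<alpha> - \<alpha> / real n"
          unfolding split using True by (simp add: cone_step_def)
        moreover have "\<alpha> / real n = 1 / (p * real n) + 1 + 1 / p"
          unfolding \<alpha>_def \<beta>_def using qp n_pos by (simp add: field_simps)
        moreover have "0 \<le> 1 / (p * real n)" using qp by simp
        ultimately show ?thesis
          using True by (simp add: g_def \<alpha>_def)
      next
        case False
        then have wV: "w \<in> V" using w by simp
        have "(\<Sum>i\<in>V - {v}. g i * cone_step G a q p i w) = \<alpha> * q * (\<Sum>i\<in>V - {v}. adj_smat G i w)"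
          unfolding sum_distrib_left
          using False apex by (intro sum.cong) (auto simp: g_def cone_step_def)
        also have "\<dots> \<le> \<alpha> * q * (\<Sum>i\<in>V. adj_smat G i w)"
          using pos qp finite_V adj_nonneg by (intro mult_left_mono sum_mono2) auto
        also have "\<dots> = \<alpha> * (1 - p)"
          using sum_adj_V[OF wV] qp by (simp add: eq_diff_eq[symmetric])
        finally have "1 + (\<Sum>i\<in>insert a V - {v}. g i * cone_step G a q p i w) \<le> 1 + \<beta> * p + \<alpha> * (1 - p)"
          unfolding split using False by (simp add: cone_step_def)
        also have "\<dots> = \<alpha>"
          unfolding \<alpha>_def using qp by (simp add: field_simps)
        finally show ?thesis
          using False by (simp add: g_def)
      qed
    qed
  qed (use finite_V pos qp u cone_step_nonneg in \<open>auto simp: g_def\<close>)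
qed

text \<open>
  The survival probabilities of the walk killed at \<open>v\<close> agree with those of the block chain
  killed at \<open>x0\<close>.  Every block is nonempty, so summability passes to the block chain, and
  there the sum over time is an entry of \<open>H_vec\<close>.
\<close>

lemma expected_hitting_time_lumped:
  assumes qp: "0 \<le> q" "0 < p" "q * real k + p = 1"
    and P: "\<And>i j. i \<in> insert a V \<Longrightarrow> j \<in> insert a V \<Longrightarrow> P i j = cone_step G a q p i j"
    and M: "\<And>i j. i \<in> insert a1 X \<Longrightarrow> j \<in> insert a1 X \<Longrightarrow> M i j = cone_quotient_step a1 kx B n q p i j"
    and v: "v \<in> V" and u: "u \<in> insert a V" "u \<noteq> v"
  shows "expected_hitting_time (insert a V) P v u = ennreal (H_vec I0 M (fp v u))"
proof -
  let ?J = "insert a V - {v}"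
  have fp_in: "fp v w \<in> I0" if w: "w \<in> ?J" for w
    using w v apex x0_in a1_notin f_in[OF v] f_eq_x0_iff[OF v] by (auto simp: cone_fun_def)
  have lump: "survival ?J (cone_step G a q p) t w = survival I0 M t (fp v w)" if w: "w \<in> ?J" for t w
  proof -
    have "survival ?J (cone_step G a q p) t w = survival I0 (cone_quotient_step a1 kx B n q p) t (fp v w)"
      using finite_V finite_X fp_in cone_step_lumps[OF v] w by (intro survival_lump) auto
    also have "\<dots> = survival I0 M t (fp v w)"
      using M fp_in[OF w] by (intro survival_cong) auto
    finally show ?thesis .
  qed
  have onto: "\<exists>w\<in>?J. fp v w = x" if x: "x \<in> I0" for x
  proof (cases "x = a1")
    case True
    then show ?thesis using v apex by (intro bexI[of _ a]) (auto simp: cone_fun_def)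
  next
    case False
    then have "x \<in> X" "x \<noteq> x0" using x by auto
    then obtain w where "w \<in> V" "f v w = x" using fibre_nonempty[OF v] by blast
    then show ?thesis
      using v apex \<open>x \<noteq> x0\<close> f_eq_x0_iff[OF v v] by (intro bexI[of _ w]) (auto simp: cone_fun_def)
  qed
  have summ: "summable (\<lambda>t. survival I0 M t x)" if x: "x \<in> I0" for x
    using onto[OF x] survival_cone_step_summable[OF qp v] lump by auto
  have M0: "0 \<le> M i j" if "i \<in> I0" "j \<in> I0" for i j
    using that M[of i j] B_nonneg[of i j] qp by (auto simp: cone_quotient_step_def)
  have uJ: "u \<in> ?J" using u by simp
  have "expected_hitting_time (insert a V) P v u = (\<Sum>t. ennreal (survival ?J P t u))"
    using finite_V u P cone_step_nonneg[of q p] cone_step_stochastic[OF qp(3)] qp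
    by (intro expected_hitting_time_eq_suminf_survival) auto
  also have "\<dots> = (\<Sum>t. ennreal (survival ?J (cone_step G a q p) t u))"
    using P uJ by (intro suminf_cong arg_cong[where f = ennreal] survival_cong) auto
  also have "\<dots> = (\<Sum>t. ennreal (survival I0 M t (fp v u)))"
    using lump[OF uJ] by simp
  also have "\<dots> = ennreal (\<Sum>t. survival I0 M t (fp v u))"
    using survival_nonneg[OF M0 fp_in[OF uJ]] summ[OF fp_in[OF uJ]] by (intro suminf_ennreal2) auto
  also have "(\<Sum>t. survival I0 M t (fp v u)) = H_vec I0 M (fp v u)"
    using finite_X M0 summ fp_in[OF uJ] by (intro H_vec_eq_suminf_survival[symmetric]) auto
  finally show ?thesis .
qed

section \<open>The simple and the maximal entropy random walk\<close>

lemma srw_step: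
  assumes "i \<in> insert a V" "j \<in> insert a V"
  shows "T_smat (insert a V) (adj_smat K) i j =
    cone_step G a (1 / (real k + 1)) (1 / (real k + 1)) i j"
proof (cases "j = a")
  case True
  have "(\<Sum>l\<in>V. adj_smat K l a) = (\<Sum>l\<in>V. 1)"
    using apex by (intro sum.cong) (auto simp: adj_K)
  then show ?thesis
    using True assms by (simp add: T_smat_def sum_K adj_K cone_step_def)
next
  case False
  then have "(\<Sum>l\<in>V. adj_smat K l j) = (\<Sum>l\<in>V. adj_smat G l j)"
    using apex assms by (intro sum.cong) (auto simp: adj_K)
  also have "\<dots> = real k"
    using False assms by (simp add: sum_adj_V)
  finally have "(\<Sum>l\<in>V. adj_smat K l j) = real k" .
  then show ?thesis
    using False assms by (simp add: T_smat_def sum_K adj_K cone_step_def)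
qed

lemma srw_quotient_step:
  assumes "i \<in> insert a1 X" "j \<in> insert a1 X"
  shows "T_smat (insert a1 X) (cone_smat a1 kx B) i j =
    cone_quotient_step a1 kx B n (1 / (real k + 1)) (1 / (real k + 1)) i j"
proof (cases "j = a1")
  case True
  have "(\<Sum>l\<in>X. cone_smat a1 kx B l a1) = (\<Sum>l\<in>X. real (kx l))"
    using a1_notin by (intro sum.cong) (auto simp: cone_smat_def)
  then show ?thesis
    using True assms finite_X a1_notin sum_fibre_size
    by (simp add: T_smat_def cone_smat_def cone_quotient_step_def)
next
  case False
  then have "(\<Sum>l\<in>X. cone_smat a1 kx B l j) = (\<Sum>l\<in>X. B l j)"
    using a1_notin by (intro sum.cong) (auto simp: cone_smat_def)
  also have "\<dots> = real k" using B_col_sum False assms by simp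
  finally show ?thesis
    using False assms finite_X a1_notin
    by (simp add: T_smat_def cone_smat_def cone_quotient_step_def add.commute)
qed

text \<open>
  From here on \<open>l\<close> is the largest eigenvalue of the cone, characterised as the root of
  \<open>l * (l - k) = n\<close> that exceeds \<open>k\<close>.
\<close>

context
  fixes l :: real
  assumes l: "l > real k" "l * (l - real k) = real n"
begin

lemma l_pos: "0 < l"
  using l(1) of_nat_0_le_iff[of k, where 'a = real] by linarith

text \<open>
  The normalising column sum at a vertex is \<open>l\<close> times its Perron entry, which is \<open>1\<close> on \<open>G\<close>
  and \<open>l - k\<close> at the apex up to a common factor.  Between vertices of \<open>G\<close> the entries cancel and
  leave \<open>1 / l\<close>.
\<close>

lemma merw_step:
  assumes "i \<in> insert a V" "j \<in> insert a V"
  shows "T_smat (insert a V) (mult_smat (insert a V) (diag_smat (perron_vector K)) (adj_smat K)) i j =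
    cone_step G a (1 / l) ((l - real k) / l) i j"
proof -
  obtain c where c: "c > 0" and cV: "\<And>v. v \<in> V \<Longrightarrow> perron_vector K v = c"
    and ca: "perron_vector K a = c * (l - real k)"
    using perron_vector_cone[OF l] by blast
  have W: "mult_smat (insert a V) (diag_smat (perron_vector K)) (adj_smat K) i' j =
      perron_vector K i' * adj_smat K i' j" if "i' \<in> insert a V" for i'
    using that finite_V by (simp add: mult_diag_smat_left)
  have T: "T_smat (insert a V) (mult_smat (insert a V) (diag_smat (perron_vector K)) (adj_smat K)) i j =
      perron_vector K i * adj_smat K i j /
      (perron_vector K a * adj_smat K a j + (\<Sum>m\<in>V. perron_vector K m * adj_smat K m j))"
    using W assms(1) by (simp add: T_smat_def sum_K)
  show ?thesis
  proof (cases "j = a")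
    case True
    have "(\<Sum>m\<in>V. perron_vector K m * adj_smat K m j) = (\<Sum>m\<in>V. c)"
      using True apex cV by (intro sum.cong) (auto simp: adj_K)
    then show ?thesis
      unfolding T using True assms c cV by (auto simp: adj_K cone_step_def)
  next
    case False
    then have jV: "j \<in> V" using assms by simp
    have "(\<Sum>m\<in>V. perron_vector K m * adj_smat K m j) = c * (\<Sum>m\<in>V. adj_smat G m j)"
      unfolding sum_distrib_left using False apex cV jV by (intro sum.cong) (auto simp: adj_K)
    then have "perron_vector K a * adj_smat K a j + (\<Sum>m\<in>V. perron_vector K m * adj_smat K m j) = c * l"
      using False jV ca sum_adj_V[OF jV] by (simp add: adj_K algebra_simps)
    then show ?thesis
      unfolding T using False assms c cV ca apex by (auto simp: adj_K cone_step_def)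
  qed
qed

lemma block_values:
  obtains c where "c > 0" "\<And>x. x \<in> X \<Longrightarrow> block_value G a fp (perron_vector K) x = c"
    "block_value G a fp (perron_vector K) a1 = c * (l - real k)"
proof -
  obtain c where c: "c > 0" and cV: "\<And>v. v \<in> V \<Longrightarrow> perron_vector K v = c"
    and ca: "perron_vector K a = c * (l - real k)"
    using perron_vector_cone[OF l] by blast
  obtain v where v: "v \<in> V" using nonempty by blast
  have fib_X: "fibre (pverts K) fp x w = F x w" if "x \<in> X" "w \<in> V" for x w
    using that apex a1_notin by (auto simp: fibre_def pverts_K cone_fun_def)
  have fib_a1: "fibre (pverts K) fp a1 w = {a}" if "w \<in> V" for w
    using that apex a1_notin f_in[of w] by (auto simp: fibre_def pverts_K cone_fun_def)
  have "block_value G a fp (perron_vector K) x = c" if x: "x \<in> X" for x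
    unfolding block_value_def
  proof (rule the_equality)
    show "\<forall>w\<in>V. \<forall>u\<in>fibre (pverts K) fp x w. perron_vector K u = c"
      using fib_X[OF x] cV by (auto simp: fibre_def)
    fix d assume d: "\<forall>w\<in>V. \<forall>u\<in>fibre (pverts K) fp x w. perron_vector K u = d"
    obtain u where u: "u \<in> V" "f v u = x" using fibre_nonempty[OF v x] .
    then have "u \<in> fibre (pverts K) fp x v"
      using fib_X[OF x v] by (simp add: fibre_def)
    then show "d = c" using d v cV[OF u(1)] by auto
  qed
  moreover have "block_value G a fp (perron_vector K) a1 = c * (l - real k)"
    unfolding block_value_def ca[symmetric]
  proof (rule the_equality)
    show "\<forall>w\<in>V. \<forall>u\<in>fibre (pverts K) fp a1 w. perron_vector K u = perron_vector K a"
      using fib_a1 by auto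
  qed (use fib_a1 v in auto)
  ultimately show thesis using c by (rule that[rotated])
qed

text \<open>
  Conjugation by \<open>D\<close> multiplies the entry at \<open>(i, j)\<close> by the ratio of the Perron entries on the
  two blocks.  This ratio is \<open>1\<close> between blocks of \<open>G\<close>, \<open>l - k\<close> towards the apex and
  \<open>1 / (l - k)\<close> away from it; in the last case the factor \<open>1 / l\<close>
  and \<open>l * (l - k) = n\<close> make the entry \<open>k\<^sub>i / n\<close>.
\<close>

lemma merw_quotient_step:
  defines "D \<equiv> diag_smat (block_value G a fp (perron_vector K))"
  assumes i: "i \<in> insert a1 X" and j: "j \<in> insert a1 X"
  shows "1 / l * mult_smat (insert a1 X) (mult_smat (insert a1 X) D (cone_smat a1 kx B))
      (inv_smat (insert a1 X) D) i j =
    cone_quotient_step a1 kx B n (1 / l) ((l - real k) / l) i j"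
proof -
  let ?I = "insert a1 X" and ?d = "block_value G a fp (perron_vector K)"
  obtain c where c: "c > 0" and dX: "\<And>x. x \<in> X \<Longrightarrow> ?d x = c" and da: "?d a1 = c * (l - real k)"
    using block_values by blast
  have dpos: "?d x \<noteq> 0" if "x \<in> ?I" for x
    using that c dX da l(1) by auto
  have fin: "finite ?I" using finite_X by simp
  have inv: "inv_smat ?I D m j = diag_smat (\<lambda>x. 1 / ?d x) m j" if "m \<in> ?I" for m
    unfolding D_def by (rule inv_diag_smat[OF fin dpos that j])
  have "mult_smat ?I (mult_smat ?I D (cone_smat a1 kx B)) (inv_smat ?I D) i j =
      mult_smat ?I (mult_smat ?I D (cone_smat a1 kx B)) (diag_smat (\<lambda>x. 1 / ?d x)) i j"
    unfolding mult_smat_def[of _ "mult_smat _ _ _"] using inv by (intro sum.cong refl) (simp only:)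
  also have "\<dots> = ?d i * cone_smat a1 kx B i j / ?d j"
    using fin i j by (simp only: mult_diag_smat_right mult_diag_smat_left D_def) simp
  finally have *: "1 / l * mult_smat ?I (mult_smat ?I D (cone_smat a1 kx B)) (inv_smat ?I D) i j =
      ?d i * cone_smat a1 kx B i j / (l * ?d j)" by simp
  define m where "m = l - real k"
  have m: "m \<noteq> 0" "?d a1 = c * m" "real n = l * m"
    using l da by (simp_all add: m_def)
  show ?thesis
    unfolding * m(3) m_def[symmetric] cone_quotient_step_def cone_smat_def
    using i j c dX l_pos a1_notin m(1,2) by auto
qed

end

end

section \<open>Hitting times on the cone\<close>

theorem theorem4p6:
  fixes G :: "'a pair_pre_digraph"
    and f :: "'a \<Rightarrow> 'a \<Rightarrow> 'x"
    and X :: "'x set" and x0 a0 a1 :: 'x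
    and a :: 'a and k n :: nat and lambda1 :: real
    and B Bplus D Bstar :: "'x \<Rightarrow> 'x \<Rightarrow> real"
    and h h' :: "'x \<Rightarrow> real"
  assumes graph: "pair_graph G" and connected: "Digraph_Component.connected (with_proj G)"
    and regular: "\<forall>v\<in>pverts G. out_degree (with_proj G) v = k"
    and order: "card (pverts G) = n"
    and equitable: "f_equitable G f X x0 B"
    and apex: "a \<notin> pverts G"
    and names: "a0 \<noteq> a1"
      "a0 \<notin> (\<lambda>(v, u). f v u) ` (pverts G \<times> pverts G)"
      "a1 \<notin> (\<lambda>(v, u). f v u) ` (pverts G \<times> pverts G)"
    and lambda1: "lambda1 = real k / 2 + sqrt (real n + (real k)\<^sup>2 / 4)"
    and Bplus: "Bplus = cone_smat a1 (fibre_size (pverts G) f) B"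
    and D: "D = diag_smat (block_value G a (cone_fun a a0 a1 f) (perron_vector (cone_graph G a)))"
    and Bstar: "transp_smat Bstar =
      mult_smat (insert a1 X) (mult_smat (insert a1 X) D Bplus) (inv_smat (insert a1 X) D)"
    and h: "h = H_vec (insert a1 X - {x0}) (T_smat (insert a1 X) Bplus)"
    and h': "h' = H_vec (insert a1 X - {x0}) (\<lambda>i j. 1 / lambda1 * transp_smat Bstar i j)"
  shows "\<forall>v\<in>pverts (cone_graph G a). \<forall>u\<in>pverts (cone_graph G a). u \<noteq> v \<longrightarrow>
    H_srw (cone_graph G a) v u =
      ennreal (if v = a then real k + 1 else h (cone_fun a a0 a1 f v u)) \<and>
    H_merw (cone_graph G a) v u =
      ennreal (if v = a then lambda1\<^sup>2 / real n else h' (cone_fun a a0 a1 f v u))"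
proof -
  have nonempty: "pverts G \<noteq> {}"
    using connected by (simp add: Digraph_Component.connected_def strongly_connected_def)
  have "a1 \<notin> X"
  proof
    assume a1: "a1 \<in> X"
    obtain v where v: "v \<in> pverts G" using nonempty by blast
    have "partition_on (pverts G) ((\<lambda>x. fibre (pverts G) f x v) ` X)"
      using equitable v by (simp add: f_equitable_def equitable_partition_def)
    then have "fibre (pverts G) f a1 v \<noteq> {}"
      using a1 by (auto simp: partition_on_def)
    then show False
      using names(3) v by (force simp: fibre_def)
  qed
  then interpret equitable_cone G k a f X x0 a0 a1 B
    using graph nonempty regular apex connected equitable
    by (intro equitable_cone.intro regular_cone.intro equitable_cone_axioms.intro)
  define s where "s = sqrt (real n + (real k)\<^sup>2 / 4)"
  have s2: "s\<^sup>2 = real n + (real k)\<^sup>2 / 4"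
    unfolding s_def by simp
  have "n > 0" using n_pos order by simp
  have "real k / 2 < s"
    unfolding s_def using \<open>n > 0\<close> by (intro real_less_rsqrt) (simp add: power_divide)
  then have l1: "lambda1 > real k"
    unfolding lambda1 s_def by simp
  have "lambda1 * (lambda1 - real k) = s\<^sup>2 - (real k)\<^sup>2 / 4"
    unfolding lambda1 s_def[symmetric] by (simp add: power2_eq_square field_simps)
  then have l2: "lambda1 * (lambda1 - real k) = real (card (pverts G))"
    using s2 order by simp
  have lpos: "0 < lambda1"
    using l_pos[OF l1 l2] .
  have srw: "0 \<le> 1 / (real k + 1)" "0 < 1 / (real k + 1)"
      "1 / (real k + 1) * real k + 1 / (real k + 1) = 1"
    by (simp_all add: field_simps)
  have merw: "0 \<le> 1 / lambda1" "0 < (lambda1 - real k) / lambda1"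
      "1 / lambda1 * real k + (lambda1 - real k) / lambda1 = 1"
    using l1 lpos by (simp_all add: field_simps)
  have "lambda1\<^sup>2 / real n = lambda1\<^sup>2 / (lambda1 * (lambda1 - real k))"
    using l2 order by simp
  then have "1 / ((lambda1 - real k) / lambda1) = lambda1\<^sup>2 / real n"
    using lpos by (simp add: power2_eq_square)
  then show ?thesis
    using expected_hitting_time_apex[OF srw srw_step]
      expected_hitting_time_apex[OF merw merw_step[OF l1 l2]]
      expected_hitting_time_lumped[OF srw srw_step srw_quotient_step]
      expected_hitting_time_lumped[OF merw merw_step[OF l1 l2] merw_quotient_step[OF l1 l2]]
      apex
    unfolding H_srw_def H_merw_def pverts_K h h' Bplus Bstar D
    by simp
qed

end
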